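(* Let $n\ge 4$ and $g\ge 0$. For $1\le p\le n-1$ let $C_p=(n,1,\ldots,p-1,n-1,p,\ldots,n-2)\in\mathfrak{S}_n$, and let the number of $(p,n-1,n)$-dipoles in an orientable surface of genus $g$ be the number of $n$-cycles $\sigma\in\mathfrak{S}_n$ with $\sigma^{-1}(n)=n-1$ such that $\sigma C_p$ has exactly $n-2g$ cycles. Then this number equals $(n-2)!\,[t^{n-2g}]D_{n,p}(t)$, where, when $2\le p\le \frac n2$, \begin{align*} D_{n,p}(t)&=\binom{t+n-1}{n}+\sum_{p\le k\le n-p-1}\frac{(n-1)(n-p)}{k(n-k-1)}\binom{t+n-k-1}{n}\\ &\quad+\binom{t}{n}-\sum_{p-1\le k\le n-p-1}\frac{n-p}{(n-k-1)(k+1)}\,t\binom{t+n-k-2}{n-1}, \end{align*} and, when $\frac n2\le p\le n-1$, \begin{align*} D_{n,p}(t)&=\binom{t+n-1}{n}-\sum_{n-p\le k\le p-1}\frac{(n-1)(n-p)}{k(n-k-1)}\binom{t+n-k-1}{n}\\ &\quad+\binom{t}{n}+\sum_{n-p\le k\le p-2}\frac{n-p}{(n-k-1)(k+1)}\,t\binom{t+n-k-2}{n-1}. \end{align*}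
   Context: $\binom{t+a}{r}=\frac{(t+a)(t+a-1)\cdots(t+a-r+1)}{r!}$ is regarded as a polynomial in $t$, and $[t^m]$ denotes coefficient extraction. Combinatorial meaning: a dipole is a 2-cell embedding in an orientable surface of a loopless graph with exactly two vertices, rooted at a vertex and an edge (labelled $n$), with a second distinguished edge (labelled $n-1$), the other edges labelled canonically. $C_p$ is the counterclockwise rotation at the root vertex (root jump, i.e. one plus the number of edges strictly between the root edge and the distinguished edge counterclockwise around the root vertex, equal to $p$) and $\sigma$ is the rotation at the non-root vertex (non-root jump $n-1$); the faces correspond to the cycles of $\sigma C_p$, so by the Euler–Poincaré formula a dipole with $n$ edges and $m$ faces lies on the surface of genus $\frac12(n-m)$.
   Formalization: At p = n/2 the last sum of the second formula (n−p ≤ k ≤ p−2) is read as minus its term at k = p−1 rather than as empty; read as empty, the second formula is false there (n = 4, p = 2, g = 0 would give 1/6). *)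

theory Defs
  imports
    Complex_Main
    "HOL-Combinatorics.Combinatorics"
    "HOL-Computational_Algebra.Polynomial"
begin

definition n_cycles :: "nat \<Rightarrow> (nat \<Rightarrow> nat) set" where
  "n_cycles n = {cycle_of_list cs | cs. distinct cs \<and> set cs = {1..n}}"

text \<open>Fixed points count as cycles of length one.\<close>

definition num_cycles :: "nat \<Rightarrow> (nat \<Rightarrow> nat) \<Rightarrow> nat" where
  "num_cycles n \<pi> = card (orbit \<pi> ` {1..n})"

definition C_perm :: "nat \<Rightarrow> nat \<Rightarrow> nat \<Rightarrow> nat" where
  "C_perm n p = cycle_of_list (n # [1..<p] @ [n - 1] @ [p..<n - 1])"

text \<open>
  The number of cycles is compared in the integers, since \<open>n - 2 g\<close> may be negative
  (the count is then zero). Reading the product in the opposite order replaces it by a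
  conjugate permutation, so the order of composition is immaterial.
\<close>

definition num_dipoles :: "nat \<Rightarrow> nat \<Rightarrow> nat \<Rightarrow> nat" where
  "num_dipoles n p g =
     card {\<sigma> \<in> n_cycles n. inv \<sigma> n = n - 1 \<and>
            int (num_cycles n (\<sigma> \<circ> C_perm n p)) = int n - 2 * int g}"

definition tvar :: "rat poly" where
  "tvar = [:0, 1:]"

definition binom_poly :: "int \<Rightarrow> nat \<Rightarrow> rat poly" where
  "binom_poly a r = smult (1 / fact r) (\<Prod>i = 0..<r. tvar + of_int a - of_nat i)"

definition coeff_int :: "rat poly \<Rightarrow> int \<Rightarrow> rat" where
  "coeff_int q m = (if m < 0 then 0 else coeff q (nat m))"

text \<open>
  The sum over \<open>a \<le> k \<le> b\<close>, with the usual convention (Karr) for reversed bounds: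
  it is the ordinary sum when \<open>a \<le> b + 1\<close>, and otherwise minus the sum over
  \<open>b < k < a\<close>. In the polynomials below the bounds are reversed in one place only: the
  last sum of \<open>D_high\<close> when \<open>2 p = n\<close>, where it runs over \<open>p \<le> k \<le> p - 2\<close>. There the
  convention is what makes \<open>D_low\<close> and \<open>D_high\<close> agree; with an empty sum they differ.
\<close>

definition range_sum :: "int \<Rightarrow> int \<Rightarrow> (int \<Rightarrow> rat poly) \<Rightarrow> rat poly" where
  "range_sum a b f = (if a \<le> b + 1 then (\<Sum>k = a..b. f k) else - (\<Sum>k = b + 1..a - 1. f k))"

definition D_low :: "nat \<Rightarrow> nat \<Rightarrow> rat poly" where
  "D_low n p =
     binom_poly (int n - 1) n
     + range_sum (int p) (int n - int p - 1)
         (\<lambda>k. smult (of_int ((int n - 1) * (int n - int p)) / of_int (k * (int n - k - 1)))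
               (binom_poly (int n - k - 1) n))
     + binom_poly 0 n
     - range_sum (int p - 1) (int n - int p - 1)
         (\<lambda>k. smult (of_int (int n - int p) / of_int ((int n - k - 1) * (k + 1)))
               (tvar * binom_poly (int n - k - 2) (n - 1)))"

definition D_high :: "nat \<Rightarrow> nat \<Rightarrow> rat poly" where
  "D_high n p =
     binom_poly (int n - 1) n
     - range_sum (int n - int p) (int p - 1)
         (\<lambda>k. smult (of_int ((int n - 1) * (int n - int p)) / of_int (k * (int n - k - 1)))
               (binom_poly (int n - k - 1) n))
     + binom_poly 0 n
     + range_sum (int n - int p) (int p - 2)
         (\<lambda>k. smult (of_int (int n - int p) / of_int ((int n - k - 1) * (k + 1)))
               (tvar * binom_poly (int n - k - 2) (n - 1)))"

lemma poly_binom_poly: "poly (binom_poly a r) x = (x + of_int a) gchoose r"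
  by (simp add: binom_poly_def tvar_def gbinomial_prod_rev poly_prod)

lemma range_sum_ordinary: "a \<le> b + 1 \<Longrightarrow> range_sum a b f = (\<Sum>k = a..b. f k)"
  by (simp add: range_sum_def)

lemma D_low_eq_D_high: "n = 2 * p \<Longrightarrow> D_low n p = D_high n p"
  by (simp add: D_low_def D_high_def range_sum_def)

end

theory Submission
  imports Defs "HOL-Computational_Algebra.Formal_Power_Series"
begin

text \<open>
  Since \<open>\<sigma>(n - 1) = n\<close>, erasing \<open>n\<close> turns the count into one over all \<open>(n - 1)\<close>-cycles
  \<open>\<sigma>'\<close> on \<open>{1..n - 1}\<close>, with \<open>C\<^sub>p\<close> replaced by a permutation of cycle type \<open>(p - 1, n - p)\<close>
  and the number of cycles of the product unchanged.

  For a permutation \<open>f\<close> of \<open>N\<close> points with cycle lengths \<open>d\<^sub>1, d\<^sub>2, \<dots>\<close>, a theorem of Stanley says that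
  the series in \<open>X\<close> whose coefficient at \<open>X ^ t\<close> is the sum of \<open>t ^ cycles (\<sigma> f)\<close> over all
  \<open>N\<close>-cycles \<open>\<sigma>\<close> equals \<open>(N - 1)! X (1 - X ^ d\<^sub>1) (1 - X ^ d\<^sub>2) \<dots> / (1 - X) ^ (N + 2)\<close>. It follows by
  induction on \<open>N\<close>, erasing one point and summing over its predecessor in \<open>\<sigma>\<close>.

  For cycle type \<open>(p - 1, n - p)\<close> the coefficient is \<open>(n - 2)!\<close> times
  \<open>B\<^sub>0 - B\<^sub>p\<^sub>-\<^sub>1 - B\<^sub>n\<^sub>-\<^sub>p + B\<^sub>n\<^sub>-\<^sub>1\<close>, where \<open>B\<^sub>k\<close> is the binomial coefficient of \<open>t + n - k - 1\<close> over \<open>n\<close>.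
  The sums in \<open>D_low\<close> and \<open>D_high\<close> telescope to this, because \<open>t\<close> times the binomial coefficient of
  \<open>t + n - k - 2\<close> over \<open>n - 1\<close> is \<open>(k + 1) B\<^sub>k + (n - k - 1) B\<^sub>k\<^sub>+\<^sub>1\<close>.
\<close>

section \<open>Erasing a point from a permutation\<close>

text \<open>\<open>perm_delete a f\<close> erases \<open>a\<close> from its cycle in \<open>f\<close>.\<close>

definition perm_delete :: "'a \<Rightarrow> ('a \<Rightarrow> 'a) \<Rightarrow> 'a \<Rightarrow> 'a" where
  "perm_delete a f = transpose a (f a) \<circ> f"

lemma perm_delete_apply:
  assumes "inj f"
  shows "perm_delete a f y = (if y = a then a else if f y = a then f a else f y)"
  using assms by (auto simp: perm_delete_def transpose_def inj_eq)

lemma perm_delete_permutes: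
  "f permutes insert a S \<Longrightarrow> perm_delete a f permutes S"
  unfolding perm_delete_def by (rule permutes_insert_lemma)

lemma perm_delete_fixed: "f a = a \<Longrightarrow> perm_delete a f = f"
  by (simp add: perm_delete_def)

lemma orbit_perm_delete:
  assumes "inj f" "f a \<noteq> a" "y \<noteq> a"
  shows "orbit (perm_delete a f) y = orbit f y - {a}"
proof -
  note del = perm_delete_apply[OF assms(1), of a]
  show ?thesis
  proof (intro equalityI subsetI)
    fix z assume "z \<in> orbit (perm_delete a f) y"
    then show "z \<in> orbit f y - {a}"
    proof induction
      case base
      then show ?case
        using assms orbit.base[of f y] orbit.step[OF orbit.base, of f y] by (auto simp: del)
    next
      case (step z)
      then show ?case
        using assms orbit.step[of z f y] orbit.step[of a f y] by (auto simp: del)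
    qed
  next
    fix z assume z: "z \<in> orbit f y - {a}"
    \<comment> \<open>The erased trajectory jumps over a, so at z = a the induction has to remember
      the successor \<open>f a\<close> instead.\<close>
    have "(z \<noteq> a \<longrightarrow> z \<in> orbit (perm_delete a f) y) \<and> (z = a \<longrightarrow> f a \<in> orbit (perm_delete a f) y)"
      if "z \<in> orbit f y"
      using that
    proof induction
      case base
      then show ?case
        using orbit.base[of "perm_delete a f" y] assms del[of y] by auto
    next
      case (step z)
      then show ?case
        using orbit.step[of z "perm_delete a f" y] assms(2) del[of z] by (cases "z = a"; cases "f z = a") simp_all
    qed
    with z show "z \<in> orbit (perm_delete a f) y" by blast
  qed
qed

text \<open>Since \<open>\<sigma>\<close> fixes a, moving it past the transposition of a and
  \<open>f a\<close> yields the transposition of a and \<open>\<sigma> (f a)\<close>.\<close>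

lemma perm_delete_comp_fixing:
  assumes "inj \<sigma>" "\<sigma> a = a"
  shows "perm_delete a (\<sigma> \<circ> f) = \<sigma> \<circ> perm_delete a f"
proof -
  have "\<sigma> z = a \<longleftrightarrow> z = a" for z using assms by (metis injD)
  then show ?thesis
    using assms by (simp add: perm_delete_def transpose_def fun_eq_iff inj_eq) metis
qed

text \<open>The case x = \<open>f a\<close> is included: the composite then already fixes a, and
  \<open>transpose (f a) x\<close> is the identity.\<close>

lemma perm_delete_transpose_comp:
  assumes "x \<noteq> a" "f a \<noteq> a"
  shows "perm_delete a (transpose x a \<circ> f) = transpose (f a) x \<circ> perm_delete a f"
  using assms by (auto simp: perm_delete_def transpose_def fun_eq_iff)

lemma perm_delete_transpose_comp_fixed:
  assumes "f a = a"
  shows "perm_delete a (transpose x a \<circ> f) = f"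
  using assms by (auto simp: perm_delete_def transpose_def fun_eq_iff)

lemma orbit_eq_orbit_of_mem:
  assumes "permutation f" "x \<in> orbit f y"
  shows "orbit f x = orbit f y"
  using cyclic_on_orbit'[OF assms(1), of y] assms(2) by (rule orbit_cyclic_eq3)

definition cycle_count :: "'a set \<Rightarrow> ('a \<Rightarrow> 'a) \<Rightarrow> nat" where
  "cycle_count S f = card (orbit f ` S)"

text \<open>The orbit of a moved point a also passes through \<open>f a\<close> in S, so removing a
  from each orbit matches old and new orbits one to one. A fixed point a is a cycle of its own,
  which is lost.\<close>

lemma cycle_count_perm_delete:
  assumes f: "f permutes insert a S" and S: "finite S" "a \<notin> S"
  shows "cycle_count (insert a S) f = cycle_count S (perm_delete a f) + (if f a = a then 1 else 0)"
proof -
  have perm: "permutation f"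
    using f S by (auto simp: permutation_permutes)
  have inj: "inj f" using f by (rule permutes_inj)
  show ?thesis
  proof (cases "f a = a")
    case True
    then have fS: "f permutes S"
      using perm_delete_permutes[OF f] by (simp add: perm_delete_fixed)
    have "orbit f a = {a}" using True by (simp add: orbit_eq_singleton_iff)
    moreover have "{a} \<notin> orbit f ` S"
      using permutes_orbit_subset[OF fS] S by fastforce
    ultimately show ?thesis
      using True S by (simp add: cycle_count_def perm_delete_fixed)
  next
    case False
    have "f a \<in> S" using permutes_in_image[OF f, of a] False by auto
    moreover have "orbit f (f a) = orbit f a"
      using perm by (rule permutation_orbit_step)
    ultimately have ins: "orbit f ` insert a S = orbit f ` S"
      by (metis image_insert insert_absorb rev_image_eqI)
    have "orbit (perm_delete a f) ` S = (\<lambda>A. A - {a}) ` (orbit f ` S)"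
      unfolding image_image using S by (intro image_cong orbit_perm_delete inj False) auto
    \<comment> \<open>An orbit without a still contains its representative y in S, and y determines
      the orbit.\<close>
    moreover have "inj_on (\<lambda>A. A - {a}) (orbit f ` S)"
    proof (rule inj_onI, clarify)
      fix y z assume yz: "y \<in> S" "z \<in> S" "orbit f y - {a} = orbit f z - {a}"
      then have "y \<in> orbit f z"
        using permutation_self_in_orbit[OF perm, of y] S by blast
      then show "orbit f y = orbit f z" using orbit_eq_orbit_of_mem[OF perm] by blast
    qed
    ultimately show ?thesis
      using False ins by (simp add: cycle_count_def card_image)
  qed
qed

section \<open>Long cycles and the insertion of a point into them\<close>

definition cyclic_perms :: "'a set \<Rightarrow> ('a \<Rightarrow> 'a) set" where
  "cyclic_perms S = {\<sigma>. \<sigma> permutes S \<and> cyclic_on \<sigma> S}"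

lemma finite_cyclic_perms: "finite S \<Longrightarrow> finite (cyclic_perms S)"
  unfolding cyclic_perms_def by (rule finite_subset[OF _ finite_permutations]) auto

lemma perm_delete_comp_transpose:
  assumes "\<sigma> permutes S" "a \<notin> S" "x \<in> S"
  shows "perm_delete a (\<sigma> \<circ> transpose x a) = \<sigma>"
proof -
  have inj: "inj \<sigma>" using assms(1) by (rule permutes_inj)
  have \<sigma>a: "\<sigma> a = a" using assms by (simp add: permutes_not_in)
  then have "\<sigma> z = a \<longleftrightarrow> z = a" for z using inj by (metis injD)
  then show ?thesis
    using \<sigma>a inj by (simp add: perm_delete_def transpose_def fun_eq_iff inj_eq) metis
qed

text \<open>The product sends x to a and a to \<open>\<sigma> x\<close>, so a is inserted just after
  x. Erasing a again shows that the orbit of x covers S.\<close>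

lemma comp_transpose_in_cyclic_perms:
  assumes \<sigma>: "\<sigma> \<in> cyclic_perms S" and S: "a \<notin> S" "x \<in> S"
  shows "\<sigma> \<circ> transpose x a \<in> cyclic_perms (insert a S)"
proof -
  let ?f = "\<sigma> \<circ> transpose x a"
  have p: "\<sigma> permutes S" and c: "cyclic_on \<sigma> S"
    using \<sigma> by (auto simp: cyclic_perms_def)
  have fp: "?f permutes insert a S"
    using p S by (intro permutes_compose permutes_swap_id) (auto intro: permutes_subset)
  have "\<sigma> x \<in> S" using permutes_in_image[OF p] S by simp
  then have "?f a \<noteq> a" using S by auto
  moreover have "x \<noteq> a" using S by auto
  ultimately have "S = orbit ?f x - {a}"
    using orbit_perm_delete[OF permutes_inj[OF fp], of a x] perm_delete_comp_transpose[OF p S]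
      orbit_cyclic_eq3[OF c S(2)] by simp
  moreover have "a \<in> orbit ?f x"
    using orbit.base[of ?f x] permutes_not_in[OF p S(1)] by simp
  ultimately have "insert a S = orbit ?f x" by auto
  then show ?thesis using fp S by (auto simp: cyclic_perms_def intro: cyclic_on_singleI)
qed

text \<open>Here \<open>x\<close> is the predecessor of \<open>a\<close> in the long cycle, and \<open>\<sigma>\<close> is what remains after erasing \<open>a\<close>.\<close>

lemma bij_betw_cyclic_perms_insert:
  assumes S: "S \<noteq> {}" "a \<notin> S"
  shows "bij_betw (\<lambda>(x, \<sigma>). \<sigma> \<circ> transpose x a) (S \<times> cyclic_perms S) (cyclic_perms (insert a S))"
proof (rule bij_betwI[where g = "\<lambda>f. (inv f a, perm_delete a f)"])
  show "(\<lambda>(x, \<sigma>). \<sigma> \<circ> transpose x a) \<in> S \<times> cyclic_perms S \<rightarrow> cyclic_perms (insert a S)"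
    using comp_transpose_in_cyclic_perms[OF _ S(2)] by auto
next
  show "(\<lambda>f. (inv f a, perm_delete a f)) \<in> cyclic_perms (insert a S) \<rightarrow> S \<times> cyclic_perms S"
  proof
    fix f assume "f \<in> cyclic_perms (insert a S)"
    then have f: "f permutes insert a S" and c: "cyclic_on f (insert a S)"
      by (auto simp: cyclic_perms_def)
    have ne: "f a \<noteq> a"
    proof
      assume "f a = a"
      then have "orbit f a = {a}" by (simp add: orbit_eq_singleton_iff)
      then show False using orbit_cyclic_eq3[OF c, of a] S by auto
    qed
    then have "inv f a \<noteq> a" using f by (metis permutes_inverses(1))
    then have i: "inv f a \<in> S"
      using permutes_in_image[OF permutes_inv[OF f], of a] by auto
    obtain s where s: "s \<in> S" using S by auto
    then have "orbit (perm_delete a f) s = S"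
      using orbit_perm_delete[OF permutes_inj[OF f] ne, of s] orbit_cyclic_eq3[OF c, of s] S by auto
    then show "(inv f a, perm_delete a f) \<in> S \<times> cyclic_perms S"
      using i s perm_delete_permutes[OF f] by (auto simp: cyclic_perms_def intro: cyclic_on_singleI)
  qed
next
  fix z assume "z \<in> S \<times> cyclic_perms S"
  then obtain x \<sigma> where z: "z = (x, \<sigma>)" "x \<in> S" and p: "\<sigma> permutes S"
    by (auto simp: cyclic_perms_def)
  have "inj (\<sigma> \<circ> transpose x a)"
    using permutes_inj[OF p] by (intro inj_compose) auto
  moreover have "(\<sigma> \<circ> transpose x a) x = a"
    using permutes_not_in[OF p S(2)] by simp
  ultimately have "inv (\<sigma> \<circ> transpose x a) a = x" by (rule inv_f_eq)
  then show "(inv ((\<lambda>(x, \<sigma>). \<sigma> \<circ> transpose x a) z) a, perm_delete a ((\<lambda>(x, \<sigma>). \<sigma> \<circ> transpose x a) z)) = z"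
    using z perm_delete_comp_transpose[OF p S(2) z(2)] by simp
next
  fix f assume "f \<in> cyclic_perms (insert a S)"
  then have f: "f permutes insert a S" by (auto simp: cyclic_perms_def)
  have "transpose a (f a) (f (transpose (inv f a) a y)) = f y" for y
    using permutes_inverses[OF f] by (auto simp: transpose_def) (metis permutes_inverses(2)[OF f])+
  then show "(\<lambda>(x, \<sigma>). \<sigma> \<circ> transpose x a) (inv f a, perm_delete a f) = f"
    by (auto simp: perm_delete_def fun_eq_iff)
qed

section \<open>Multiplication by a transposition\<close>

text \<open>Used to follow \<open>transpose u x \<circ> f\<close> along a cycle of f until the first
  arrow into u or x.\<close>

lemma funpow_eq_prefix:
  assumes "\<And>j. j < k \<Longrightarrow> g ((f ^^ j) y) = f ((f ^^ j) y)" "j \<le> k"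
  shows "(g ^^ j) y = (f ^^ j) y"
  using assms(2)
proof (induction j)
  case (Suc j)
  then show ?case using assms(1)[of j] by simp
qed simp

lemma orbit_eq_image_funpow:
  assumes "(f ^^ k) y = y" "0 < k"
  shows "orbit f y = (\<lambda>j. (f ^^ j) y) ` {..<k}"
  using orbit_altdef_bounded[OF assms] by auto

lemma
  assumes "permutation f"
  shows funpow_card_orbit: "(f ^^ card (orbit f y)) y = y"
    and inj_on_funpow_orbit: "inj_on (\<lambda>j. (f ^^ j) y) {..<card (orbit f y)}"
    and card_orbit_pos: "0 < card (orbit f y)"
proof -
  \<comment> \<open>The first return time of y, which turns out to be the size of its orbit.\<close>
  let ?d = "funpow_dist1 f y y"
  have y: "y \<in> orbit f y" using assms by (rule permutation_self_in_orbit)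
  have fixed: "(f ^^ ?d) y = y" using y by (rule funpow_dist1_prop)
  have inj: "inj_on (\<lambda>j. (f ^^ j) y) {..<?d}"
    using funpow_neq_less_funpow_dist1[OF y] by (fastforce intro: inj_onI)
  have "orbit f y = (\<lambda>j. (f ^^ j) y) ` {..<?d}"
    using fixed by (rule orbit_eq_image_funpow) simp
  then have "card (orbit f y) = ?d"
    using card_image[OF inj] by simp
  then show "(f ^^ card (orbit f y)) y = y" "inj_on (\<lambda>j. (f ^^ j) y) {..<card (orbit f y)}"
      "0 < card (orbit f y)"
    using fixed inj by auto
qed

lemma orbit_eq_image_funpow_card:
  "permutation f \<Longrightarrow> orbit f y = (\<lambda>j. (f ^^ j) y) ` {..<card (orbit f y)}"
  using orbit_eq_image_funpow funpow_card_orbit card_orbit_pos by metis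

lemma orbit_disjoint:
  assumes "permutation f" "y \<notin> orbit f z"
  shows "orbit f y \<inter> orbit f z = {}"
proof (rule ccontr)
  assume "orbit f y \<inter> orbit f z \<noteq> {}"
  then obtain w where "w \<in> orbit f y" "w \<in> orbit f z" by blast
  then have "orbit f y = orbit f z"
    using orbit_eq_orbit_of_mem[OF assms(1)] by metis
  then show False using assms permutation_self_in_orbit[OF assms(1), of y] by simp
qed

lemma orbit_transpose_comp_unaffected:
  assumes "permutation f" "u \<notin> orbit f y" "x \<notin> orbit f y"
  shows "orbit (transpose u x \<circ> f) y = orbit f y"
proof (rule orbit_cong)
  show "y \<in> orbit f y" using assms(1) by (rule permutation_self_in_orbit)
next
  fix s assume "s \<in> orbit f y"
  then have "f s \<in> orbit f y" by (rule orbit.step)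
  then have "f s \<noteq> u" "f s \<noteq> x" using assms by auto
  then show "(transpose u x \<circ> f) s = f s" by (simp add: transpose_def)
qed

text \<open>Composing with the transposition exchanges the arrows into u and x. On the cycle of u,
  the point at position i - 1 now returns to u and the last point goes to x, so the cycle falls
  apart at position i.\<close>

lemma
  fixes f :: "'a \<Rightarrow> 'a"
  assumes f: "permutation f" and i: "0 < i" "i < card (orbit f u)" and x: "x = (f ^^ i) u"
  shows orbit_transpose_split_fst:
      "orbit (transpose u x \<circ> f) u = (\<lambda>j. (f ^^ j) u) ` {..<i}"
    and orbit_transpose_split_snd:
      "orbit (transpose u x \<circ> f) x = (\<lambda>j. (f ^^ j) u) ` {i..<card (orbit f u)}"
proof -
  let ?e = "card (orbit f u)"
  define g where "g = transpose u x \<circ> f"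
  have g_apply: "g y = transpose u x (f y)" for y by (simp add: g_def)
  have inj: "(f ^^ j) u = (f ^^ k) u \<longleftrightarrow> j = k" if "j < ?e" "k < ?e" for j k
    using inj_on_funpow_orbit[OF f, of u] that by (auto simp: inj_on_def)
  have g_eq: "g ((f ^^ j) u) = f ((f ^^ j) u)" if "Suc j < ?e" "Suc j \<noteq> i" for j
    using inj[of "Suc j" 0] inj[of "Suc j" i] that i by (simp add: g_apply x transpose_def)
  have "(g ^^ j) u = (f ^^ j) u" if "j \<le> i - 1" for j
    using g_eq i that by (intro funpow_eq_prefix) auto
  note 1 = this
  have "(g ^^ Suc (i - 1)) u = transpose u x (f ((f ^^ (i - 1)) u))"
    using 1[of "i - 1"] by (simp add: g_apply)
  also have "f ((f ^^ (i - 1)) u) = (f ^^ Suc (i - 1)) u" by simp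
  also have "transpose u x \<dots> = u" using i by (simp add: x)
  finally have "(g ^^ i) u = u" using i by simp
  then have "orbit g u = (\<lambda>j. (g ^^ j) u) ` {..<i}" using i by (intro orbit_eq_image_funpow)
  also have "\<dots> = (\<lambda>j. (f ^^ j) u) ` {..<i}" using 1 i by (intro image_cong) auto
  finally show "orbit (transpose u x \<circ> f) u = (\<lambda>j. (f ^^ j) u) ` {..<i}"
    unfolding g_def .
  have shift: "(f ^^ j) x = (f ^^ (j + i)) u" for j by (simp add: x funpow_add)
  have "(g ^^ j) x = (f ^^ j) x" if "j \<le> ?e - i - 1" for j
  proof (rule funpow_eq_prefix[OF _ that])
    fix j assume "j < ?e - i - 1"
    then show "g ((f ^^ j) x) = f ((f ^^ j) x)" using g_eq[of "j + i"] i shift by auto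
  qed
  note 2 = this
  have "(g ^^ Suc (?e - i - 1)) x = transpose u x (f ((f ^^ (?e - i - 1)) x))"
    using 2[of "?e - i - 1"] by (simp add: g_apply)
  also have "f ((f ^^ (?e - i - 1)) x) = (f ^^ Suc (?e - i - 1 + i)) u"
    by (simp only: shift funpow.simps comp_apply)
  also have "Suc (?e - i - 1 + i) = ?e" using i by simp
  also have "transpose u x ((f ^^ ?e) u) = x" using funpow_card_orbit[OF f, of u] by simp
  finally have "(g ^^ (?e - i)) x = x" using i by (simp add: Suc_diff_Suc)
  then have "orbit g x = (\<lambda>j. (g ^^ j) x) ` {..<?e - i}" using i by (intro orbit_eq_image_funpow) auto
  also have "\<dots> = (\<lambda>j. (f ^^ (j + i)) u) ` {..<?e - i}" using 2 i shift by (intro image_cong) auto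
  also have "\<dots> = (\<lambda>j. (f ^^ j) u) ` ((\<lambda>j. j + i) ` {..<?e - i})" by (simp add: image_image)
  also have "(\<lambda>j. j + i) ` {..<?e - i} = {i..<?e}"
    using i image_add_atLeastLessThan'[of i 0 "?e - i"] by (simp add: lessThan_atLeast0)
  finally show "orbit (transpose u x \<circ> f) x = (\<lambda>j. (f ^^ j) u) ` {i..<?e}"
    unfolding g_def .
qed

text \<open>The arrows into u and x lie on different cycles. Exchanging them makes the trajectory of
  u run through its own cycle, arrive at x, run through the cycle of x and only then return to
  u.\<close>

lemma orbit_transpose_merge:
  assumes f: "permutation f" and x: "x \<notin> orbit f u"
  shows "orbit (transpose u x \<circ> f) u = orbit f u \<union> orbit f x"
proof -
  let ?e = "card (orbit f u)" and ?d = "card (orbit f x)"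
  define g where "g = transpose u x \<circ> f"
  have g_apply: "g y = transpose u x (f y)" for y by (simp add: g_def)
  have u: "u \<notin> orbit f x"
    using x orbit_disjoint[OF f x] permutation_self_in_orbit[OF f] by blast
  have step: "g ((f ^^ j) y) = f ((f ^^ j) y)"
    if "y = u \<or> y = x" "Suc j < card (orbit f y)" for j y
  proof -
    have "(f ^^ Suc j) y \<noteq> (f ^^ 0) y"
      using inj_onD[OF inj_on_funpow_orbit[OF f, of y], of "Suc j" 0] that(2) by auto
    moreover have "(f ^^ Suc j) y \<in> orbit f y"
      using permutation_self_in_orbit[OF f] by (rule funpow_in_orbit)
    ultimately have "f ((f ^^ j) y) \<noteq> u" "f ((f ^^ j) y) \<noteq> x" using that(1) u x by auto
    then show ?thesis by (simp add: g_apply transpose_def)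
  qed
  have pre: "(g ^^ j) y = (f ^^ j) y" if "y = u \<or> y = x" "j \<le> card (orbit f y) - 1" for j y
    using step[OF that(1)] that(2) by (intro funpow_eq_prefix) auto
  \<comment> \<open>One full turn of either old cycle now ends at the base point of the
    other.\<close>
  have last: "(g ^^ card (orbit f y)) y = transpose u x y" if "y = u \<or> y = x" for y
  proof -
    have s: "Suc (card (orbit f y) - 1) = card (orbit f y)" using card_orbit_pos[OF f, of y] by simp
    have "(g ^^ Suc (card (orbit f y) - 1)) y = transpose u x ((f ^^ Suc (card (orbit f y) - 1)) y)"
      using pre[OF that, of "card (orbit f y) - 1"] by (simp add: g_apply)
    then show ?thesis unfolding s funpow_card_orbit[OF f] .
  qed
  have eu: "(g ^^ ?e) u = x" using last[of u] by simp
  have dx: "(g ^^ ?d) x = u" using last[of x] by simp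
  have tail: "(g ^^ (j + ?e)) u = (g ^^ j) x" for j by (simp add: funpow_add eu)
  have "(g ^^ (?d + ?e)) u = u" by (simp only: tail dx)
  then have "orbit g u = (\<lambda>j. (g ^^ j) u) ` {..<?d + ?e}"
    using card_orbit_pos[OF f, of u] by (intro orbit_eq_image_funpow) auto
  also have "{..<?d + ?e} = {..<?e} \<union> (\<lambda>j. j + ?e) ` {..<?d}"
    using image_add_atLeastLessThan'[of ?e 0 ?d] by (auto simp: lessThan_atLeast0 add.commute)
  also have "(\<lambda>j. (g ^^ j) u) ` \<dots> = (\<lambda>j. (g ^^ j) u) ` {..<?e} \<union> (\<lambda>j. (g ^^ j) x) ` {..<?d}"
    by (simp only: image_Un image_image tail)
  also have "(\<lambda>j. (g ^^ j) u) ` {..<?e} = (\<lambda>j. (f ^^ j) u) ` {..<?e}"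
    using pre[of u] by (intro image_cong) auto
  also have "\<dots> = orbit f u" using orbit_eq_image_funpow_card[OF f] by metis
  also have "(\<lambda>j. (g ^^ j) x) ` {..<?d} = (\<lambda>j. (f ^^ j) x) ` {..<?d}"
    using pre[of x] by (intro image_cong) auto
  also have "\<dots> = orbit f x" using orbit_eq_image_funpow_card[OF f] by metis
  finally show ?thesis unfolding g_def .
qed

section \<open>How a transposition changes the product over cycle lengths\<close>

text \<open>The factor of the numerator in Stanley's formula that depends on f. Indexing by the set
  of orbits lets each cycle contribute once.\<close>

definition cycle_weight :: "'a set \<Rightarrow> ('a \<Rightarrow> 'a) \<Rightarrow> rat fps" where
  "cycle_weight S f = (\<Prod>A\<in>orbit f ` S. 1 - fps_X ^ card A)"

definition other_orbits :: "'a set \<Rightarrow> ('a \<Rightarrow> 'a) \<Rightarrow> 'a \<Rightarrow> 'a set set" where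
  "other_orbits S f u = orbit f ` (S - orbit f u)"

context
  fixes S :: "'a set" and f :: "'a \<Rightarrow> 'a" and u :: 'a
  assumes S: "finite S" and fS: "f permutes S" and u: "u \<in> S"
begin

private lemma perm: "permutation f"
  using S fS by (auto simp: permutation_permutes)

private lemma perm_transpose: "permutation (transpose u x \<circ> f)"
  using perm by (intro permutation_compose permutation_swap_id)

private lemma orbit_sub: "y \<in> S \<Longrightarrow> orbit f y \<subseteq> S"
  using permutes_orbit_subset[OF fS] .

private lemma self: "y \<in> orbit f y"
  using permutation_self_in_orbit[OF perm] .

lemma finite_other_orbits: "finite (other_orbits S f u)"
  using S by (simp add: other_orbits_def)

lemma other_orbits_disjoint: "A \<in> other_orbits S f u \<Longrightarrow> A \<inter> orbit f u = {}"
  using orbit_disjoint[OF perm] by (auto simp: other_orbits_def)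

lemma finite_other_orbit: "A \<in> other_orbits S f u \<Longrightarrow> finite A"
  using orbit_sub S by (auto simp: other_orbits_def intro: finite_subset)

lemma Union_other_orbits: "\<Union>(other_orbits S f u) = S - orbit f u"
proof
  show "\<Union>(other_orbits S f u) \<subseteq> S - orbit f u"
    using orbit_sub other_orbits_disjoint by (fastforce simp: other_orbits_def)
  show "S - orbit f u \<subseteq> \<Union>(other_orbits S f u)"
    using self by (auto simp: other_orbits_def)
qed

lemma orbit_image_eq_other: "orbit f ` S = insert (orbit f u) (other_orbits S f u)"
proof
  show "orbit f ` S \<subseteq> insert (orbit f u) (other_orbits S f u)"
    using orbit_eq_orbit_of_mem[OF perm, of _ u] unfolding other_orbits_def by blast
  show "insert (orbit f u) (other_orbits S f u) \<subseteq> orbit f ` S"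
    using u by (auto simp: other_orbits_def)
qed

lemma cycle_weight_eq_other:
  "cycle_weight S f = (1 - fps_X ^ card (orbit f u)) * (\<Prod>A\<in>other_orbits S f u. 1 - fps_X ^ card A)"
proof -
  have "orbit f u \<notin> other_orbits S f u"
    using other_orbits_disjoint[of "orbit f u"] orbit_nonempty[of f u] by blast
  then show ?thesis
    by (simp add: cycle_weight_def orbit_image_eq_other finite_other_orbits)
qed

lemma orbit_other_unaffected:
  assumes "y \<notin> orbit f u" "y \<notin> orbit f x"
  shows "orbit (transpose u x \<circ> f) y = orbit f y"
proof (rule orbit_transpose_comp_unaffected[OF perm])
  show "u \<notin> orbit f y" using orbit_disjoint[OF perm assms(1)] self[of u] by blast
  show "x \<notin> orbit f y" using orbit_disjoint[OF perm assms(2)] self[of x] by blast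
qed

lemma cycle_weight_transpose_split:
  assumes i: "0 < i" "i < card (orbit f u)"
  shows "cycle_weight S (transpose u ((f ^^ i) u) \<circ> f) =
    (1 - fps_X ^ i) * (1 - fps_X ^ (card (orbit f u) - i)) *
    (\<Prod>A\<in>other_orbits S f u. 1 - fps_X ^ card A)"
proof -
  let ?x = "(f ^^ i) u" and ?e = "card (orbit f u)"
  let ?g = "transpose u ?x \<circ> f" and ?h = "\<lambda>j. (f ^^ j) u"
  have x: "?x \<in> orbit f u" using self by (rule funpow_in_orbit)
  have xu: "orbit f ?x = orbit f u" using perm x by (rule orbit_eq_orbit_of_mem)
  define A where "A = orbit ?g u"
  define B where "B = orbit ?g ?x"
  have A: "A = ?h ` {..<i}" unfolding A_def by (rule orbit_transpose_split_fst[OF perm i refl])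
  have B: "B = ?h ` {i..<?e}" unfolding B_def by (rule orbit_transpose_split_snd[OF perm i refl])
  have inj: "inj_on ?h {..<?e}" by (rule inj_on_funpow_orbit[OF perm])
  have cA: "card A = i" unfolding A using i card_image[OF inj_on_subset[OF inj, of "{..<i}"]] by auto
  have cB: "card B = ?e - i" unfolding B using card_image[OF inj_on_subset[OF inj, of "{i..<?e}"]] by (simp add: subset_eq)
  have AB: "A \<union> B = orbit f u"
  proof -
    have "{..<i} \<union> {i..<?e} = {..<?e}" using i by auto
    then show ?thesis
      unfolding A B by (metis image_Un orbit_eq_image_funpow_card[OF perm])
  qed
  have "A \<inter> B = {}"
    unfolding A B using i by (subst inj_on_image_Int[OF inj, symmetric]) (auto simp: subset_eq)
  moreover have "A \<noteq> {}" "B \<noteq> {}" by (simp_all add: A_def B_def orbit_nonempty)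
  ultimately have ne: "A \<noteq> B" by blast
  have nA: "A \<notin> other_orbits S f u" "B \<notin> other_orbits S f u"
    using other_orbits_disjoint AB \<open>A \<noteq> {}\<close> \<open>B \<noteq> {}\<close> by blast+
  have orb: "orbit ?g y = A" if "y \<in> A" for y
    using that orbit_eq_orbit_of_mem[OF perm_transpose] unfolding A_def by blast
  have orb': "orbit ?g y = B" if "y \<in> B" for y
    using that orbit_eq_orbit_of_mem[OF perm_transpose] unfolding B_def by blast
  have "S = A \<union> B \<union> (S - orbit f u)" using AB orbit_sub[OF u] by blast
  then have "orbit ?g ` S = orbit ?g ` A \<union> orbit ?g ` B \<union> orbit ?g ` (S - orbit f u)"
    by (metis image_Un)
  also have "orbit ?g ` (S - orbit f u) = other_orbits S f u"
    unfolding other_orbits_def using orbit_other_unaffected xu by (intro image_cong) auto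
  also have "orbit ?g ` A = {A}" using orb \<open>A \<noteq> {}\<close> by auto
  also have "orbit ?g ` B = {B}" using orb' \<open>B \<noteq> {}\<close> by auto
  finally have "orbit ?g ` S = insert A (insert B (other_orbits S f u))" by (simp only: Un_insert_left Un_empty_left)
  then show ?thesis
    using ne nA cA cB finite_other_orbits by (simp add: cycle_weight_def mult.assoc)
qed

lemma cycle_weight_transpose_merge:
  assumes x: "x \<in> S" "x \<notin> orbit f u"
  shows "cycle_weight S (transpose u x \<circ> f) =
    (1 - fps_X ^ (card (orbit f u) + card (orbit f x))) *
    (\<Prod>A\<in>other_orbits S f u - {orbit f x}. 1 - fps_X ^ card A)"
proof -
  let ?g = "transpose u x \<circ> f"
  define A where "A = orbit ?g u"
  have A: "A = orbit f u \<union> orbit f x"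
    unfolding A_def using perm x(2) by (rule orbit_transpose_merge)
  have disj: "orbit f u \<inter> orbit f x = {}" using orbit_disjoint[OF perm x(2)] by blast
  have fin: "finite (orbit f u)" "finite (orbit f x)"
    using orbit_sub u x S by (auto intro: finite_subset)
  have cA: "card A = card (orbit f u) + card (orbit f x)"
    unfolding A using disj fin by (simp add: card_Un_disjoint)
  have nA: "A \<notin> other_orbits S f u"
    using other_orbits_disjoint[of A] self[of u] by (auto simp: A)
  have orb: "orbit ?g y = A" if "y \<in> A" for y
    using that orbit_eq_orbit_of_mem[OF perm_transpose] unfolding A_def by blast
  have "S = A \<union> (S - orbit f u - orbit f x)" using orbit_sub u x by (auto simp: A)
  then have "orbit ?g ` S = orbit ?g ` A \<union> orbit ?g ` (S - orbit f u - orbit f x)"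
    by (metis image_Un)
  also have "orbit ?g ` (S - orbit f u - orbit f x) = orbit f ` (S - orbit f u - orbit f x)"
    using orbit_other_unaffected by (intro image_cong) auto
  also have "\<dots> = other_orbits S f u - {orbit f x}"
    using orbit_eq_orbit_of_mem[OF perm] self by (auto simp: other_orbits_def)
  also have "orbit ?g ` A = {A}" using orb self[of u] by (auto simp: A)
  finally have "orbit ?g ` S = insert A (other_orbits S f u - {orbit f x})" by (simp only: insert_is_Un[symmetric])
  then show ?thesis
    using nA cA finite_other_orbits by (simp add: cycle_weight_def)
qed

text \<open>A point x at distance i from u on the same cycle splits that cycle into lengths i and e
  - i. A point x on another cycle A merges A with the cycle of u, and all \<open>card A\<close>
  choices of x give the same weight.\<close>

lemma sum_cycle_weight_transpose:
  defines "e \<equiv> card (orbit f u)" and "Q \<equiv> other_orbits S f u"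
  shows "(\<Sum>x\<in>S - {u}. cycle_weight S (transpose u x \<circ> f)) =
    (\<Sum>i\<in>{0<..<e}. (1 - fps_X ^ i) * (1 - fps_X ^ (e - i))) * (\<Prod>A\<in>Q. 1 - fps_X ^ card A) +
    (\<Sum>A\<in>Q. of_nat (card A) * (1 - fps_X ^ (e + card A)) * (\<Prod>B\<in>Q - {A}. 1 - fps_X ^ card B))"
proof -
  let ?W = "\<lambda>x. cycle_weight S (transpose u x \<circ> f)"
  have inj: "inj_on (\<lambda>j. (f ^^ j) u) {..<e}"
    unfolding e_def by (rule inj_on_funpow_orbit[OF perm])
  have "S - {u} = (orbit f u - {u}) \<union> (S - orbit f u)" using orbit_sub[OF u] self by blast
  then have "sum ?W (S - {u}) = sum ?W (orbit f u - {u}) + sum ?W (S - orbit f u)"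
    using S orbit_sub[OF u] finite_subset by (subst sum.union_disjoint[symmetric]) auto
  moreover have "sum ?W (orbit f u - {u}) =
      (\<Sum>i\<in>{0<..<e}. (1 - fps_X ^ i) * (1 - fps_X ^ (e - i))) * (\<Prod>A\<in>Q. 1 - fps_X ^ card A)"
  proof -
    have "orbit f u - {u} = (\<lambda>j. (f ^^ j) u) ` {..<e} - (\<lambda>j. (f ^^ j) u) ` {0}"
      unfolding e_def using orbit_eq_image_funpow_card[OF perm, of u] by simp
    also have "\<dots> = (\<lambda>j. (f ^^ j) u) ` ({..<e} - {0})"
      using card_orbit_pos[OF perm, of u]
      by (intro inj_on_image_set_diff[OF inj, symmetric]) (auto simp: e_def)
    also have "{..<e} - {0} = {0<..<e}" by auto
    finally have "sum ?W (orbit f u - {u}) = (\<Sum>i\<in>{0<..<e}. ?W ((f ^^ i) u))"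
      using inj_on_subset[OF inj, of "{0<..<e}"] by (simp add: sum.reindex subset_eq)
    also have "\<dots> = (\<Sum>i\<in>{0<..<e}. (1 - fps_X ^ i) * (1 - fps_X ^ (e - i)) * (\<Prod>A\<in>Q. 1 - fps_X ^ card A))"
      using cycle_weight_transpose_split by (intro sum.cong) (auto simp: e_def Q_def)
    finally show ?thesis by (simp add: sum_distrib_right)
  qed
  moreover have "sum ?W (S - orbit f u) =
      (\<Sum>A\<in>Q. of_nat (card A) * (1 - fps_X ^ (e + card A)) * (\<Prod>B\<in>Q - {A}. 1 - fps_X ^ card B))"
  proof -
    have "sum ?W (\<Union>Q) = (\<Sum>A\<in>Q. sum ?W A)"
    proof (rule sum.Union_disjoint[unfolded comp_def])
      show "\<forall>A\<in>Q. finite A" using finite_other_orbit by (simp add: Q_def)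
      show "\<forall>A\<in>Q. \<forall>B\<in>Q. A \<noteq> B \<longrightarrow> A \<inter> B = {}"
        unfolding Q_def other_orbits_def
        using orbit_disjoint[OF perm] orbit_eq_orbit_of_mem[OF perm] by fast
    qed
    also have "\<dots> = (\<Sum>A\<in>Q. of_nat (card A) * (1 - fps_X ^ (e + card A)) * (\<Prod>B\<in>Q - {A}. 1 - fps_X ^ card B))"
    proof (rule sum.cong[OF refl])
      fix A assume A: "A \<in> Q"
      have "?W x = (1 - fps_X ^ (e + card A)) * (\<Prod>B\<in>Q - {A}. 1 - fps_X ^ card B)" if "x \<in> A" for x
      proof -
        have "x \<in> S - orbit f u" using that A Union_other_orbits by (auto simp: Q_def)
        moreover have "orbit f x = A"
          using that A orbit_eq_orbit_of_mem[OF perm] by (auto simp: Q_def other_orbits_def)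
        ultimately show ?thesis
          using cycle_weight_transpose_merge[of x] by (simp add: e_def Q_def)
      qed
      then show "sum ?W A = of_nat (card A) * (1 - fps_X ^ (e + card A)) * (\<Prod>B\<in>Q - {A}. 1 - fps_X ^ card B)"
        by (simp add: mult.assoc)
    qed
    finally show ?thesis using Union_other_orbits by (simp add: Q_def)
  qed
  ultimately show ?thesis by simp
qed

end

text \<open>Putting a back lengthens the cycle through \<open>f a\<close> by one and leaves all
  other cycles alone.\<close>

lemma cycle_weight_insert:
  assumes S: "finite S" "a \<notin> S" and f: "f permutes insert a S" and fa: "f a \<noteq> a"
  defines "h \<equiv> perm_delete a f"
  shows "cycle_weight (insert a S) f =
    (1 - fps_X ^ Suc (card (orbit h (f a)))) * (\<Prod>A\<in>other_orbits S h (f a). 1 - fps_X ^ card A)"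
proof -
  have perm: "permutation f" using f S by (auto simp: permutation_permutes)
  note self = permutation_self_in_orbit[OF perm]
  have faS: "f a \<in> S" using permutes_in_image[OF f, of a] fa by auto
  have h: "orbit h y = orbit f y - {a}" if "y \<noteq> a" for y
    unfolding h_def using permutes_inj[OF f] fa that by (rule orbit_perm_delete)
  have step: "orbit f (f a) = orbit f a" using perm by (rule permutation_orbit_step)
  have hfa: "orbit h (f a) = orbit f a - {a}" using h[OF fa] step by simp
  have fin: "finite (orbit f a)"
    using permutes_orbit_subset[OF f, of a] S by (auto intro: finite_subset)
  have oth: "orbit h y = orbit f y" if "y \<in> S - orbit f a" for y
    using that S h[of y] orbit_disjoint[OF perm, of y a] self[of a] by auto
  have sets: "S - orbit h (f a) = S - orbit f a" using hfa S by auto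
  have "insert a S = orbit f a \<union> (S - orbit f a)"
    using permutes_orbit_subset[OF f, of a] self by auto
  then have "orbit f ` insert a S = orbit f ` orbit f a \<union> orbit f ` (S - orbit f a)"
    by (metis image_Un)
  also have "orbit f ` orbit f a = {orbit f a}"
  proof -
    have "orbit f ` orbit f a = (\<lambda>_. orbit f a) ` orbit f a"
      by (rule image_cong[OF refl], rule orbit_eq_orbit_of_mem[OF perm])
    then show ?thesis using self[of a] by auto
  qed
  also have "orbit f ` (S - orbit f a) = other_orbits S h (f a)"
    unfolding other_orbits_def sets using oth by (intro image_cong) auto
  finally have "orbit f ` insert a S = insert (orbit f a) (other_orbits S h (f a))" by simp
  moreover have "orbit f a \<notin> other_orbits S h (f a)"
    unfolding other_orbits_def sets using oth self by auto
  moreover have "card (orbit f a) = Suc (card (orbit h (f a)))"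
    unfolding hfa using fin self[of a] by (metis card.remove)
  ultimately show ?thesis
    using S by (simp add: cycle_weight_def other_orbits_def)
qed

lemma cycle_weight_insert_fixed:
  assumes S: "finite S" "a \<notin> S" and f: "f permutes S"
  shows "cycle_weight (insert a S) f = (1 - fps_X) * cycle_weight S f"
proof -
  have "orbit f a = {a}" using permutes_not_in[OF f] S by (simp add: orbit_eq_singleton_iff)
  moreover have "{a} \<notin> orbit f ` S" using permutes_orbit_subset[OF f] S by fastforce
  ultimately show ?thesis using S by (simp add: cycle_weight_def)
qed

section \<open>Products of a long cycle with a fixed permutation\<close>

text \<open>Here a is erased from the product. As \<open>\<sigma>\<close> fixes a, the product fixes
  a exactly when x = \<open>f a\<close>, and only then is a cycle lost. For \<open>f a = a\<close>
  this cannot happen, because x lies in S.\<close>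

lemma cycle_count_comp_transpose_comp:
  assumes S: "finite S" "a \<notin> S" and f: "f permutes insert a S"
    and \<sigma>: "\<sigma> permutes S" and x: "x \<in> S"
  shows "cycle_count (insert a S) (\<sigma> \<circ> transpose x a \<circ> f) =
    cycle_count S (\<sigma> \<circ> (if f a = a then f else transpose (f a) x \<circ> perm_delete a f)) +
    (if x = f a then 1 else 0)"
proof -
  have xa: "x \<noteq> a" using S x by auto
  have \<sigma>a: "\<sigma> a = a" using \<sigma> S by (simp add: permutes_not_in)
  have inj: "inj \<sigma>" using \<sigma> by (rule permutes_inj)
  have "transpose x a \<circ> f permutes insert a S"
    using f x by (intro permutes_compose[OF _ permutes_swap_id]) auto
  then have p: "\<sigma> \<circ> (transpose x a \<circ> f) permutes insert a S"
    using permutes_subset[OF \<sigma>, of "insert a S"] by (rule permutes_compose) auto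
  have "perm_delete a (\<sigma> \<circ> (transpose x a \<circ> f)) = \<sigma> \<circ> perm_delete a (transpose x a \<circ> f)"
    using inj \<sigma>a by (rule perm_delete_comp_fixing)
  also have "perm_delete a (transpose x a \<circ> f) =
      (if f a = a then f else transpose (f a) x \<circ> perm_delete a f)"
    using perm_delete_transpose_comp[OF xa] perm_delete_transpose_comp_fixed by auto
  finally have d: "perm_delete a (\<sigma> \<circ> (transpose x a \<circ> f)) =
      \<sigma> \<circ> (if f a = a then f else transpose (f a) x \<circ> perm_delete a f)" .
  have "(\<sigma> \<circ> (transpose x a \<circ> f)) a = a \<longleftrightarrow> transpose x a (f a) = a"
    using inj \<sigma>a by (metis comp_apply injD)
  also have "\<dots> \<longleftrightarrow> x = f a" using xa by (auto simp: transpose_def)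
  finally have e: "(\<sigma> \<circ> (transpose x a \<circ> f)) a = a \<longleftrightarrow> x = f a" .
  show ?thesis
    using cycle_count_perm_delete[OF p S] unfolding d e by (simp only: comp_assoc)
qed

text \<open>
  A polynomial in \<open>t\<close> is encoded by the generating function of its values at \<open>t = 0, 1, \<dots>\<close>,
  so that multiplication by \<open>t\<close> becomes \<open>X d/dX\<close>.
\<close>

definition count_series :: "nat \<Rightarrow> rat fps" where
  "count_series k = Abs_fps (\<lambda>t. of_nat t ^ k)"

lemma count_series_Suc: "count_series (Suc k) = fps_X * fps_deriv (count_series k)"
proof (rule fps_ext)
  fix t show "fps_nth (count_series (Suc k)) t = fps_nth (fps_X * fps_deriv (count_series k)) t"
    by (cases t) (simp_all add: count_series_def)
qed

text \<open>Obtained by differentiating the geometric series identity for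
  \<open>count_series 0\<close>, all of whose coefficients are 1 because 0 ^ 0 = 1.\<close>

lemma count_series_1: "(1 - fps_X) ^ 2 * count_series 1 = fps_X"
proof -
  let ?c = "count_series 0"
  have c: "(1 - fps_X) * ?c = 1"
  proof (rule fps_ext)
    fix t show "fps_nth ((1 - fps_X) * ?c) t = fps_nth 1 t"
      by (cases t) (simp_all add: count_series_def algebra_simps)
  qed
  have "fps_deriv ((1 - fps_X) * ?c) = 0" unfolding c by simp
  then have "(1 - fps_X) * fps_deriv ?c = ?c" by (simp add: algebra_simps)
  then have "(1 - fps_X) ^ 2 * fps_deriv ?c = 1"
    using c by (simp add: power2_eq_square mult.assoc)
  moreover have "count_series 1 = fps_X * fps_deriv ?c"
    using count_series_Suc[of 0] by simp
  ultimately show ?thesis by (simp add: mult.left_commute)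
qed

definition cycle_series :: "'a set \<Rightarrow> ('a \<Rightarrow> 'a) \<Rightarrow> rat fps" where
  "cycle_series S f = (\<Sum>\<sigma>\<in>cyclic_perms S. count_series (cycle_count S (\<sigma> \<circ> f)))"

lemma cycle_series_insert:
  assumes S: "finite S" "S \<noteq> {}" "a \<notin> S" and f: "f permutes insert a S"
  shows "cycle_series (insert a S) f = (\<Sum>x\<in>S. \<Sum>\<sigma>\<in>cyclic_perms S.
    count_series (cycle_count S (\<sigma> \<circ> (if f a = a then f else transpose (f a) x \<circ> perm_delete a f)) +
      (if x = f a then 1 else 0)))"
proof -
  have "cycle_series (insert a S) f =
      (\<Sum>(x, \<sigma>)\<in>S \<times> cyclic_perms S. count_series (cycle_count (insert a S) (\<sigma> \<circ> transpose x a \<circ> f)))"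
    unfolding cycle_series_def
    by (subst sum.reindex_bij_betw[OF bij_betw_cyclic_perms_insert[OF S(2,3)], symmetric])
      (simp add: case_prod_unfold)
  also have "\<dots> = (\<Sum>x\<in>S. \<Sum>\<sigma>\<in>cyclic_perms S. count_series (cycle_count (insert a S) (\<sigma> \<circ> transpose x a \<circ> f)))"
    by (rule sum.cartesian_product[symmetric])
  also have "\<dots> = (\<Sum>x\<in>S. \<Sum>\<sigma>\<in>cyclic_perms S.
    count_series (cycle_count S (\<sigma> \<circ> (if f a = a then f else transpose (f a) x \<circ> perm_delete a f)) +
      (if x = f a then 1 else 0)))"
    by (intro sum.cong refl arg_cong[where f = count_series] cycle_count_comp_transpose_comp S f)
      (auto simp: cyclic_perms_def)
  finally show ?thesis .
qed

text \<open>Every predecessor x of a leaves the same product on S and adds no cycle, so the sum over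
  x only contributes a factor.\<close>

lemma cycle_series_insert_fixed:
  assumes S: "finite S" "S \<noteq> {}" "a \<notin> S" and f: "f permutes S"
  shows "cycle_series (insert a S) f = of_nat (card S) * cycle_series S f"
proof -
  have fa: "f a = a" using f S by (simp add: permutes_not_in)
  have f': "f permutes insert a S" using f by (rule permutes_subset) auto
  have "cycle_series (insert a S) f = (\<Sum>x\<in>S. cycle_series S f)"
    unfolding cycle_series_insert[OF S f'] unfolding cycle_series_def
    using S fa by (intro sum.cong) auto
  then show ?thesis by simp
qed

lemma cycle_series_insert_moved:
  assumes S: "finite S" "S \<noteq> {}" "a \<notin> S" and f: "f permutes insert a S" and fa: "f a \<noteq> a"
  defines "h \<equiv> perm_delete a f"
  shows "cycle_series (insert a S) f =
    fps_X * fps_deriv (cycle_series S h) + (\<Sum>x\<in>S - {f a}. cycle_series S (transpose (f a) x \<circ> h))"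
proof -
  have u: "f a \<in> S" using permutes_in_image[OF f, of a] fa by auto
  have "cycle_series (insert a S) f = (\<Sum>x\<in>S. \<Sum>\<sigma>\<in>cyclic_perms S.
    count_series (cycle_count S (\<sigma> \<circ> (transpose (f a) x \<circ> h)) + (if x = f a then 1 else 0)))"
    unfolding cycle_series_insert[OF S f] h_def using fa by simp
  \<comment> \<open>The term x = \<open>f a\<close> is split off: its transposition is trivial and
    its count is larger by one.\<close>
  also have "\<dots> = (\<Sum>\<sigma>\<in>cyclic_perms S. count_series (Suc (cycle_count S (\<sigma> \<circ> h)))) +
      (\<Sum>x\<in>S - {f a}. cycle_series S (transpose (f a) x \<circ> h))"
    unfolding sum.remove[OF S(1) u] cycle_series_def by (intro arg_cong2[where f = "(+)"] sum.cong) auto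
  also have "(\<Sum>\<sigma>\<in>cyclic_perms S. count_series (Suc (cycle_count S (\<sigma> \<circ> h)))) =
      fps_X * fps_deriv (cycle_series S h)"
    by (simp add: count_series_Suc cycle_series_def fps_deriv_sum sum_distrib_left)
  finally show ?thesis .
qed

section \<open>Power series identities for Stanley's formula\<close>

text \<open>Multiplying out leaves the powers \<open>X ^ i\<close> and \<open>X ^ (e - i)\<close>,
  whose sums agree under i to e - i. The factor 1 - X turns this common geometric sum into a closed
  form.\<close>

lemma sum_complementary_weights:
  fixes X :: "'a :: comm_ring_1"
  assumes "0 < e"
  shows "(1 - X) * (\<Sum>i\<in>{0<..<e}. (1 - X ^ i) * (1 - X ^ (e - i))) =
    (of_nat e - 1) * (1 + X ^ e) * (1 - X) - 2 * (X - X ^ e)"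
proof -
  have geo: "(1 - X) * (\<Sum>i\<in>{0<..<e}. X ^ i) = X - X ^ e"
  proof -
    have "{..<e} = insert 0 {0<..<e}" using assms by auto
    then have "(\<Sum>i<e. X ^ i) = 1 + (\<Sum>i\<in>{0<..<e}. X ^ i)" by simp
    then show ?thesis using one_diff_power_eq[of X e] by (simp add: algebra_simps)
  qed
  have refl: "(\<Sum>i\<in>{0<..<e}. X ^ (e - i)) = (\<Sum>i\<in>{0<..<e}. X ^ i)"
    by (rule sum.reindex_bij_witness[where i = "\<lambda>i. e - i" and j = "\<lambda>i. e - i"]) auto
  have "(\<Sum>i\<in>{0<..<e}. (1 - X ^ i) * (1 - X ^ (e - i))) =
      (\<Sum>i\<in>{0<..<e}. 1 + X ^ e - X ^ i - X ^ (e - i))"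
    by (intro sum.cong) (auto simp: algebra_simps simp flip: power_add)
  also have "\<dots> = of_nat (e - 1) * (1 + X ^ e) - 2 * (\<Sum>i\<in>{0<..<e}. X ^ i)"
    by (simp add: sum_subtractf refl)
  also have "(1 - X) * \<dots> = of_nat (e - 1) * (1 + X ^ e) * (1 - X) - 2 * ((1 - X) * (\<Sum>i\<in>{0<..<e}. X ^ i))"
    by (simp add: algebra_simps)
  finally show ?thesis using assms geo by (simp add: of_nat_diff)
qed

lemma fps_X_times_deriv_power: "fps_X * fps_deriv (fps_X ^ k :: rat fps) = of_nat k * fps_X ^ k"
  by (induction k) (simp_all add: algebra_simps)

lemma fps_deriv_one_minus_X_power:
  "fps_deriv ((1 - fps_X) ^ Suc k :: rat fps) = - (of_nat (Suc k) * (1 - fps_X) ^ k)"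
proof (induction k)
  case (Suc k)
  have "fps_deriv ((1 - fps_X) ^ Suc (Suc k) :: rat fps) =
      (1 - fps_X) * fps_deriv ((1 - fps_X) ^ Suc k) - (1 - fps_X) ^ Suc k"
    by (subst power_Suc) (simp del: power_Suc)
  then show ?case unfolding Suc by (simp add: algebra_simps)
qed simp

text \<open>The logarithmic derivative of the product, written without division.\<close>

lemma fps_X_times_deriv_prod:
  fixes Q :: "'a set" and c :: "'a \<Rightarrow> nat"
  assumes "finite Q"
  shows "fps_X * fps_deriv (\<Prod>A\<in>Q. 1 - fps_X ^ c A :: rat fps) =
    - (\<Sum>A\<in>Q. of_nat (c A) * fps_X ^ c A * (\<Prod>B\<in>Q - {A}. 1 - fps_X ^ c B))"
  using assms
proof induction
  case (insert A Q)
  let ?P = "\<lambda>Q. \<Prod>B\<in>Q. 1 - fps_X ^ c B :: rat fps"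
  have "(\<Sum>B\<in>insert A Q. of_nat (c B) * fps_X ^ c B * ?P (insert A Q - {B})) =
      of_nat (c A) * fps_X ^ c A * ?P Q +
      (\<Sum>B\<in>Q. of_nat (c B) * fps_X ^ c B * ?P (insert A Q - {B}))"
    using insert by simp
  also have "(\<Sum>B\<in>Q. of_nat (c B) * fps_X ^ c B * ?P (insert A Q - {B})) =
      (\<Sum>B\<in>Q. (1 - fps_X ^ c A) * (of_nat (c B) * fps_X ^ c B * ?P (Q - {B})))"
  proof (rule sum.cong[OF refl])
    fix B assume "B \<in> Q"
    then have "insert A Q - {B} = insert A (Q - {B})" using insert by auto
    then show "of_nat (c B) * fps_X ^ c B * ?P (insert A Q - {B}) =
        (1 - fps_X ^ c A) * (of_nat (c B) * fps_X ^ c B * ?P (Q - {B}))"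
      using insert by (simp add: mult_ac)
  qed
  also have "\<dots> = (1 - fps_X ^ c A) * - (fps_X * fps_deriv (?P Q))"
    using insert by (simp add: sum_distrib_left)
  finally have sum: "(\<Sum>B\<in>insert A Q. of_nat (c B) * fps_X ^ c B * ?P (insert A Q - {B})) =
      of_nat (c A) * fps_X ^ c A * ?P Q + (1 - fps_X ^ c A) * - (fps_X * fps_deriv (?P Q))" .
  have "fps_X * fps_deriv (?P (insert A Q)) =
      - ((fps_X * fps_deriv (fps_X ^ c A)) * ?P Q) + (1 - fps_X ^ c A) * (fps_X * fps_deriv (?P Q))"
    using insert.hyps by (simp add: algebra_simps)
  then show ?case unfolding sum fps_X_times_deriv_power by simp
qed simp

text \<open>
  Stanley's formula. In the step where \<open>a\<close> is not fixed, the sum over the predecessor of \<open>a\<close> in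
  \<open>\<sigma>\<close> has three parts: one term where \<open>a\<close> becomes a fixed point of the product (a factor \<open>t\<close>,
  that is \<open>X d/dX\<close>), the terms where the cycle through \<open>f a\<close> is split, and those where it is merged
  with another cycle. The derivatives of the other factors \<open>1 - X ^ d\<close> cancel against the merging
  terms, leaving \<open>d\<close> times the undisturbed product.
\<close>

theorem cycle_series_eq:
  assumes "finite S" "S \<noteq> {}" "f permutes S"
  shows "(1 - fps_X) ^ (card S + 2) * cycle_series S f =
    of_nat (fact (card S - 1)) * fps_X * cycle_weight S f"
  using assms
proof (induction S arbitrary: f rule: finite_ne_induct)
  case (singleton a)
  have perms: "g permutes {a} \<longleftrightarrow> g = id" for g :: "'a \<Rightarrow> 'a" by simp
  have orb: "orbit id a = {a}" by (simp add: orbit_eq_singleton_iff)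
  then have "cyclic_perms {a} = {id}"
    unfolding cyclic_perms_def perms by (auto simp: cyclic_on_def)
  moreover have "f = id" using singleton perms by blast
  ultimately show ?case
    using count_series_1 orb orb[unfolded id_def]
    by (simp add: cycle_series_def cycle_count_def cycle_weight_def numeral_3_eq_3 power2_eq_square mult_ac)
next
  case (insert a S)
  define m where "m = card S"
  have m: "m > 0" using insert by (auto simp: m_def card_gt_0_iff)
  have card: "card (insert a S) = Suc m" using insert by (simp add: m_def)
  obtain k where k: "m = Suc k" using m gr0_implies_Suc by blast
  show ?case
  proof (cases "f a = a")
    case True
    then have f: "f permutes S"
      using perm_delete_permutes[OF insert.prems] by (simp add: perm_delete_fixed)
    have "(1 - fps_X) ^ (Suc m + 2) * (of_nat m * cycle_series S f) =
        of_nat m * (1 - fps_X) * ((1 - fps_X) ^ (m + 2) * cycle_series S f)"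
      by (simp add: mult_ac)
    also have "\<dots> = of_nat m * (1 - fps_X) * (of_nat (fact (m - 1)) * fps_X * cycle_weight S f)"
      using insert.IH[OF f] by (simp add: m_def)
    also have "\<dots> = of_nat (fact m) * fps_X * ((1 - fps_X) * cycle_weight S f)"
      by (simp add: k algebra_simps)
    finally show ?thesis
      using insert.hyps f by (simp add: card cycle_series_insert_fixed cycle_weight_insert_fixed m_def)
  next
    case False
    \<comment> \<open>Erasing a leaves h, whose cycle through u = \<open>f a\<close> has length e. R
      is the weight of its other cycles, H comes from splitting the cycle of u, and G from merging
      it with another one.\<close>
    define u where "u = f a"
    define h where "h = perm_delete a f"
    define Q where "Q = other_orbits S h u"
    define e where "e = card (orbit h u)"
    define R where "R = (\<Prod>A\<in>Q. 1 - fps_X ^ card A :: rat fps)"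
    define F where "F = (of_nat (fact (m - 1)) :: rat fps)"
    define T where "T = cycle_series S h"
    define G where "G = (\<Sum>A\<in>Q. of_nat (card A) * (1 - fps_X ^ (e + card A)) * (\<Prod>B\<in>Q - {A}. 1 - fps_X ^ card B) :: rat fps)"
    define H where "H = (\<Sum>i\<in>{0<..<e}. (1 - fps_X ^ i) * (1 - fps_X ^ (e - i)) :: rat fps)"
    have hS: "h permutes S" unfolding h_def using insert.prems by (rule perm_delete_permutes)
    have u: "u \<in> S" using permutes_in_image[OF insert.prems, of a] False by (auto simp: u_def)
    have perm: "permutation h" using hS insert by (auto simp: permutation_permutes)
    have e: "0 < e" unfolding e_def using perm by (rule card_orbit_pos)
    have finQ: "finite Q" unfolding Q_def using insert.hyps(1) hS u by (rule finite_other_orbits)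
    have W: "cycle_weight S h = (1 - fps_X ^ e) * R"
      unfolding R_def Q_def e_def using insert.hyps(1) hS u by (rule cycle_weight_eq_other)
    \<comment> \<open>The cycle lengths of h add up to m.\<close>
    have mQ: "of_nat m = (of_nat e + (\<Sum>A\<in>Q. of_nat (card A)) :: rat fps)"
    proof -
      have "card (S - orbit h u) = (\<Sum>A\<in>Q. card A)"
        unfolding Q_def Union_other_orbits[OF insert.hyps(1) hS u, symmetric]
      proof (rule card_Union_disjoint)
        show "pairwise disjnt (other_orbits S h u)"
          unfolding other_orbits_def pairwise_def disjnt_def
          using orbit_disjoint[OF perm] orbit_eq_orbit_of_mem[OF perm] by fast
        show "finite A" if "A \<in> other_orbits S h u" for A
          using insert.hyps(1) hS u that by (rule finite_other_orbit)
      qed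
      moreover have sub: "orbit h u \<subseteq> S" using hS u by (rule permutes_orbit_subset)
      then have "card S = e + card (S - orbit h u)"
        using insert.hyps(1) by (simp add: e_def card_Diff_subset finite_subset card_mono)
      ultimately show ?thesis by (simp add: m_def)
    qed
    \<comment> \<open>For a cycle of length d, the derivative and the merging term combine to -(1 -
      \<open>X ^ e\<close>) \<open>X ^ d\<close> + 1 - \<open>X ^ (e + d)\<close> = 1 -
      \<open>X ^ d\<close>. This restores the factor missing from the product, and d summed over the
      other cycles is m - e.\<close>
    have XR: "(1 - fps_X ^ e) * (fps_X * fps_deriv R) + G = (of_nat m - of_nat e) * R"
    proof -
      have "(1 - fps_X ^ e) * (fps_X * fps_deriv R) + G =
          (\<Sum>A\<in>Q. of_nat (card A) * ((1 - fps_X ^ card A) * (\<Prod>B\<in>Q - {A}. 1 - fps_X ^ card B)))"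
        unfolding R_def fps_X_times_deriv_prod[OF finQ] G_def sum_distrib_left sum.distrib[symmetric]
          sum_negf[symmetric] mult_minus_right
        by (intro sum.cong refl) (simp add: algebra_simps power_add)
      also have "\<dots> = (\<Sum>A\<in>Q. of_nat (card A) * R)"
        unfolding R_def by (intro sum.cong refl) (simp add: prod.remove[OF finQ])
      also have "\<dots> = (of_nat m - of_nat e) * R" by (simp add: mQ sum_distrib_right)
      finally show ?thesis .
    qed
    have WX: "fps_X * fps_deriv (cycle_weight S h) =
        - (of_nat e * fps_X ^ e * R) + (1 - fps_X ^ e) * (fps_X * fps_deriv R)"
      using fps_X_times_deriv_power[of e] by (simp add: W algebra_simps)
    have dF: "fps_deriv F = 0" by (simp only: F_def fps_of_nat[symmetric] fps_deriv_const)
    have IH: "(1 - fps_X) ^ (m + 2) * T = F * fps_X * cycle_weight S h"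
      unfolding m_def F_def T_def by (rule insert.IH[OF hS])
    \<comment> \<open>Differentiating both sides of \<open>IH\<close> expresses the derivative of T
      without division.\<close>
    have "fps_deriv ((1 - fps_X) ^ (m + 2) * T) =
        (1 - fps_X) ^ (m + 2) * fps_deriv T - of_nat (m + 2) * (1 - fps_X) ^ (m + 1) * T"
      using fps_deriv_one_minus_X_power[of "m + 1"] by (simp del: power_Suc of_nat_Suc of_nat_add)
    moreover have "fps_deriv (F * fps_X * cycle_weight S h) =
        F * (cycle_weight S h + fps_X * fps_deriv (cycle_weight S h))"
      by (simp add: dF algebra_simps)
    ultimately have dT: "(1 - fps_X) ^ (m + 2) * fps_deriv T =
        F * (cycle_weight S h + fps_X * fps_deriv (cycle_weight S h)) +
        of_nat (m + 2) * (1 - fps_X) ^ (m + 1) * T"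
      unfolding IH diff_eq_eq[symmetric] by (rule trans[OF sym])
    \<comment> \<open>One more factor 1 - X raises the power in front of the leftover T to m + 2, so
      that \<open>IH\<close> eliminates T.\<close>
    have "(1 - fps_X) ^ (m + 3) * fps_deriv T = (1 - fps_X) * ((1 - fps_X) ^ (m + 2) * fps_deriv T)"
      by (simp add: numeral_3_eq_3 mult_ac)
    also have "\<dots> = F * (1 - fps_X) * (cycle_weight S h + fps_X * fps_deriv (cycle_weight S h)) +
        of_nat (m + 2) * ((1 - fps_X) ^ (m + 2) * T)"
      unfolding dT by (simp add: algebra_simps)
    finally have 1: "(1 - fps_X) ^ (m + 3) * fps_deriv T =
      F * (1 - fps_X) * (cycle_weight S h + fps_X * fps_deriv (cycle_weight S h)) +
        of_nat (m + 2) * (F * fps_X * cycle_weight S h)"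
      unfolding IH .
    have 2: "(1 - fps_X) ^ (m + 3) * (\<Sum>x\<in>S - {u}. cycle_series S (transpose u x \<circ> h)) =
        F * fps_X * ((1 - fps_X) * H * R + (1 - fps_X) * G)"
    proof -
      have "(1 - fps_X) ^ (m + 3) * (\<Sum>x\<in>S - {u}. cycle_series S (transpose u x \<circ> h)) =
          (1 - fps_X) * (\<Sum>x\<in>S - {u}. (1 - fps_X) ^ (m + 2) * cycle_series S (transpose u x \<circ> h))"
        by (simp add: numeral_3_eq_3 sum_distrib_left mult_ac)
      also have "(\<Sum>x\<in>S - {u}. (1 - fps_X) ^ (m + 2) * cycle_series S (transpose u x \<circ> h)) =
          (\<Sum>x\<in>S - {u}. F * fps_X * cycle_weight S (transpose u x \<circ> h))"
      proof (rule sum.cong[OF refl])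
        fix x assume "x \<in> S - {u}"
        then have "transpose u x \<circ> h permutes S"
          using u by (intro permutes_compose[OF hS] permutes_swap_id) auto
        then show "(1 - fps_X) ^ (m + 2) * cycle_series S (transpose u x \<circ> h) =
            F * fps_X * cycle_weight S (transpose u x \<circ> h)"
          unfolding m_def F_def by (rule insert.IH)
      qed
      also have "\<dots> = F * fps_X * (H * R + G)"
        unfolding sum_distrib_left[symmetric] H_def R_def G_def Q_def e_def
        by (subst sum_cycle_weight_transpose[OF insert.hyps(1) hS u]) (rule refl)
      also have "(1 - fps_X) * (F * fps_X * (H * R + G)) = F * fps_X * ((1 - fps_X) * H * R + (1 - fps_X) * G)"
        by (simp add: algebra_simps)
      finally show ?thesis .
    qed
    have H: "(1 - fps_X) * H = (of_nat e - 1) * (1 + fps_X ^ e) * (1 - fps_X) - 2 * (fps_X - fps_X ^ e)"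
      unfolding H_def using e by (rule sum_complementary_weights)
    have "(1 - fps_X) ^ (m + 3) * cycle_series (insert a S) f =
        fps_X * ((1 - fps_X) ^ (m + 3) * fps_deriv T) +
        (1 - fps_X) ^ (m + 3) * (\<Sum>x\<in>S - {u}. cycle_series S (transpose u x \<circ> h))"
      unfolding cycle_series_insert_moved[OF insert.hyps insert.prems False] T_def h_def u_def
      by (simp only: distrib_left mult.left_commute)
    also have "\<dots> = F * fps_X * ((1 - fps_X) * ((1 - fps_X ^ e) * R - of_nat e * fps_X ^ e * R +
          ((1 - fps_X ^ e) * (fps_X * fps_deriv R) + G)) +
        (of_nat m + 2) * fps_X * (1 - fps_X ^ e) * R + ((1 - fps_X) * H) * R)"
      unfolding 1 2 WX unfolding W by (simp add: algebra_simps)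
    \<comment> \<open>After \<open>XR\<close> and \<open>H\<close> everything cancels except m (1 -
      \<open>X ^ (e + 1)\<close>). The factor m completes the factorial, and e + 1 is the length of
      the cycle of f through a.\<close>
    also have "\<dots> = F * fps_X * (of_nat m * (1 - fps_X * fps_X ^ e) * R)"
      unfolding XR H by (simp add: algebra_simps)
    also have "\<dots> = of_nat (fact m) * fps_X * ((1 - fps_X ^ Suc e) * R)"
      by (simp add: F_def k algebra_simps)
    also have "(1 - fps_X ^ Suc e) * R = cycle_weight (insert a S) f"
      unfolding R_def Q_def e_def h_def u_def
      using cycle_weight_insert[OF insert.hyps(1,3) insert.prems False] by simp
    finally show ?thesis by (simp add: card numeral_3_eq_3)
  qed
qed

section \<open>Dipoles\<close>

lemma funpow_cycle_of_list:
  assumes "distinct cs" "j < length cs"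
  shows "(cycle_of_list cs ^^ j) (cs ! 0) = cs ! j"
proof -
  have "0 < length cs" using assms by linarith
  then have "(cycle_of_list cs ^^ j) (cs ! 0) = map (cycle_of_list cs ^^ j) cs ! 0" by simp
  also have "\<dots> = rotate j cs ! 0" by (simp only: cyclic_rotation[OF assms(1)])
  also have "\<dots> = cs ! j" using \<open>0 < length cs\<close> assms by (simp add: nth_rotate)
  finally show ?thesis .
qed

lemma orbit_cycle_of_list:
  assumes "distinct cs" "cs \<noteq> []"
  shows "orbit (cycle_of_list cs) (cs ! 0) = set cs"
proof
  show "orbit (cycle_of_list cs) (cs ! 0) \<subseteq> set cs"
    using cycle_permutes assms by (intro permutes_orbit_subset) auto
  show "set cs \<subseteq> orbit (cycle_of_list cs) (cs ! 0)"
    unfolding orbit_altdef_permutation[OF permutation_of_cycle]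
    using funpow_cycle_of_list[OF assms(1)] by (auto simp: in_set_conv_nth) metis
qed

lemma n_cycles_eq_cyclic_perms:
  assumes "0 < n"
  shows "n_cycles n = cyclic_perms {1..n}"
proof
  show "n_cycles n \<subseteq> cyclic_perms {1..n}"
  proof
    fix \<sigma> assume "\<sigma> \<in> n_cycles n"
    then obtain cs where cs: "\<sigma> = cycle_of_list cs" "distinct cs" "set cs = {1..n}"
      by (auto simp: n_cycles_def)
    then have ne: "cs \<noteq> []" using assms by auto
    then have "cs ! 0 \<in> set cs" by simp
    then have "cyclic_on \<sigma> (set cs)"
      using orbit_cycle_of_list[OF cs(2) ne] cs(1) by (intro cyclic_on_singleI) auto
    then show "\<sigma> \<in> cyclic_perms {1..n}"
      using cs cycle_permutes[of cs] by (simp add: cyclic_perms_def)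
  qed
  show "cyclic_perms {1..n} \<subseteq> n_cycles n"
  proof
    fix \<sigma> assume "\<sigma> \<in> cyclic_perms {1..n}"
    then have p: "\<sigma> permutes {1..n}" and c: "cyclic_on \<sigma> {1..n}" by (auto simp: cyclic_perms_def)
    have perm: "permutation \<sigma>" using p by (auto simp: permutation_permutes)
    \<comment> \<open>The trajectory of 1 up to its first return lists the whole cycle.\<close>
    define cs where "cs = support \<sigma> 1"
    have d: "distinct cs" unfolding cs_def by (rule cycle_of_permutation[OF perm])
    have "set cs = orbit \<sigma> 1"
      unfolding cs_def support_set[OF perm] orbit_altdef_permutation[OF perm] by auto
    also have "\<dots> = {1..n}" using c assms by (intro orbit_cyclic_eq3) auto
    finally have s: "set cs = {1..n}" .
    have "\<sigma> = cycle_of_list cs"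
    proof
      fix b
      show "\<sigma> b = cycle_of_list cs b"
      proof (cases "b \<in> set cs")
        case True
        then show ?thesis using cycle_restrict[OF perm, of b 1] by (simp only: cs_def)
      next
        case False
        then show ?thesis using s p by (simp add: id_outside_supp permutes_not_in)
      qed
    qed
    then show "\<sigma> \<in> n_cycles n" using d s by (auto simp: n_cycles_def)
  qed
qed

text \<open>
  What \<open>C\<^sub>p\<close> becomes when \<open>n\<close> is erased from \<open>\<sigma>\<close> and from the product: a permutation of
  \<open>{1..n - 1}\<close> with two cycles, of lengths \<open>p - 1\<close> and \<open>n - p\<close>.
\<close>

definition dipole_perm :: "nat \<Rightarrow> nat \<Rightarrow> nat \<Rightarrow> nat" where
  "dipole_perm n p = transpose 1 (n - 1) \<circ> cycle_of_list ([1..<p] @ [n - 1] @ [p..<n - 1])"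

context
  fixes n p :: nat
  assumes n: "4 \<le> n" and p: "2 \<le> p" "p \<le> n - 1"
begin

private abbreviation "cs \<equiv> [1..<p] @ [n - 1] @ [p..<n - 1]"

private lemma cs: "distinct cs" "set cs = {1..n - 1}" "length cs = n - 1" "cs ! 0 = 1" "cs ! (p - 1) = n - 1"
  using n p by (auto simp: nth_append)

private lemma cs_Cons: "\<exists>ds. cs = 1 # ds"
  using p by (simp add: upt_conv_Cons)

lemma C_perm_permutes: "C_perm n p permutes {1..n}"
proof -
  have "set (n # cs) = {1..n}" using n p by auto
  then show ?thesis unfolding C_perm_def by (metis cycle_permutes)
qed

lemma C_perm_n: "C_perm n p n = 1"
proof -
  obtain ds where "cs = 1 # ds" using cs_Cons by blast
  moreover from this have "n \<noteq> 1" "n \<notin> set (1 # ds)" using cs n by auto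
  ultimately show ?thesis by (simp add: C_perm_def id_outside_supp)
qed

text \<open>As the list continues with 1 after n, the recursion for \<open>cycle_of_list\<close>
  splits off the transposition of n and 1, which is exactly what erasing n cancels.\<close>

lemma perm_delete_C_perm: "perm_delete n (C_perm n p) = cycle_of_list cs"
proof -
  obtain ds where ds: "cs = 1 # ds" using cs_Cons by blast
  have "C_perm n p = transpose n 1 \<circ> cycle_of_list cs"
    unfolding C_perm_def ds by simp
  then show ?thesis
    unfolding perm_delete_def C_perm_n by (simp add: comp_assoc[symmetric])
qed

lemma dipole_perm_permutes: "dipole_perm n p permutes {1..n - 1}"
  unfolding dipole_perm_def using cs cycle_permutes[of cs] n
  by (intro permutes_compose permutes_swap_id) auto

text \<open>The cycle of length n - 1 reaches n - 1 from 1 after p - 1 steps, so the transposition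
  of these two points splits it into lengths p - 1 and n - p.\<close>

lemma cycle_weight_dipole_perm:
  "cycle_weight {1..n - 1} (dipole_perm n p) = (1 - fps_X ^ (p - 1)) * (1 - fps_X ^ (n - p))"
proof -
  let ?c = "cycle_of_list cs"
  have o1: "orbit ?c 1 = {1..n - 1}"
    using orbit_cycle_of_list[of cs] cs by force
  have card: "card (orbit ?c 1) = n - 1" unfolding o1 by simp
  have "(?c ^^ (p - 1)) 1 = n - 1"
    using funpow_cycle_of_list[OF cs(1), of "p - 1"] p n unfolding cs(3-5) by linarith
  moreover have "other_orbits {1..n - 1} ?c 1 = {}"
    unfolding other_orbits_def o1 by simp
  moreover have "?c permutes {1..n - 1}" using cycle_permutes[of cs] cs by simp
  ultimately show ?thesis
    using cycle_weight_transpose_split[of "{1..n - 1}" ?c 1 "p - 1"] n p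
    unfolding dipole_perm_def card by simp
qed

text \<open>The condition on \<open>inv \<sigma> n\<close> selects the insertions of n with
  predecessor n - 1. No cycle is lost on erasing n, since n - 1 differs from
  \<open>C_perm n p n\<close> = 1.\<close>

lemma num_dipoles_eq:
  "num_dipoles n p g = card {\<sigma> \<in> cyclic_perms {1..n - 1}.
     int (cycle_count {1..n - 1} (\<sigma> \<circ> dipole_perm n p)) = int n - 2 * int g}"
proof -
  define S where "S = {1..n - 1}"
  have ins: "{1..n} = insert n S" using n by (auto simp: S_def)
  have nS: "n \<notin> S" and mS: "n - 1 \<in> S" and fin: "finite S" and ne: "S \<noteq> {}"
    using n by (auto simp: S_def)
  let ?F = "\<lambda>\<sigma>. \<sigma> \<circ> transpose (n - 1) n"
  have count: "num_cycles n (?F \<sigma> \<circ> C_perm n p) = cycle_count S (\<sigma> \<circ> dipole_perm n p)"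
    if "\<sigma> \<in> cyclic_perms S" for \<sigma>
  proof -
    have "num_cycles n (?F \<sigma> \<circ> C_perm n p) = cycle_count (insert n S) (?F \<sigma> \<circ> C_perm n p)"
      unfolding num_cycles_def cycle_count_def ins ..
    also have "\<dots> = cycle_count S (\<sigma> \<circ> (transpose 1 (n - 1) \<circ> perm_delete n (C_perm n p)))"
      using cycle_count_comp_transpose_comp[OF fin nS C_perm_permutes[unfolded ins] _ mS, of \<sigma>] that
        C_perm_n n by (simp add: cyclic_perms_def)
    finally show ?thesis unfolding perm_delete_C_perm dipole_perm_def .
  qed
  have inv: "inv (?F \<sigma>) n = n - 1" if "\<sigma> \<in> cyclic_perms S" for \<sigma>
  proof (rule inv_f_eq)
    have \<sigma>: "\<sigma> permutes S" using that by (simp add: cyclic_perms_def)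
    show "inj (?F \<sigma>)" using permutes_inj[OF \<sigma>] by (intro inj_compose) auto
    show "?F \<sigma> (n - 1) = n" using permutes_not_in[OF \<sigma> nS] by simp
  qed
  have nc: "n_cycles n = cyclic_perms (insert n S)"
    unfolding ins[symmetric] using n by (intro n_cycles_eq_cyclic_perms) auto
  note bij = bij_betw_cyclic_perms_insert[OF ne nS]
  have set_eq: "{\<sigma> \<in> n_cycles n. inv \<sigma> n = n - 1 \<and> int (num_cycles n (\<sigma> \<circ> C_perm n p)) = int n - 2 * int g} =
      ?F ` {\<sigma> \<in> cyclic_perms S. int (cycle_count S (\<sigma> \<circ> dipole_perm n p)) = int n - 2 * int g}"
    (is "?L = ?R")
  proof
    show "?R \<subseteq> ?L"
      using comp_transpose_in_cyclic_perms[OF _ nS mS] inv count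
      by (auto simp: nc)
    show "?L \<subseteq> ?R"
    proof
      fix \<tau> assume \<tau>: "\<tau> \<in> ?L"
      then have "\<tau> \<in> cyclic_perms (insert n S)" by (simp add: nc)
      then obtain x \<sigma> where x: "x \<in> S" and \<sigma>: "\<sigma> \<in> cyclic_perms S" and eq: "\<tau> = \<sigma> \<circ> transpose x n"
        using bij_betw_imp_surj_on[OF bij] by force
      have "\<sigma> permutes S" using \<sigma> by (simp add: cyclic_perms_def)
      then have "\<tau> x = n" and "inj \<tau>"
        unfolding eq using permutes_not_in[OF _ nS] by (auto intro: inj_compose permutes_inj)
      then have "inv \<tau> n = x" by (intro inv_f_eq)
      then have "x = n - 1" using \<tau> by simp
      then show "\<tau> \<in> ?R" using \<tau> \<sigma> eq count by auto
    qed
  qed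
  have inj: "inj_on ?F A" for A
  proof (rule inj_onI)
    fix \<sigma> \<tau> assume "?F \<sigma> = ?F \<tau>"
    then have "?F \<sigma> \<circ> transpose (n - 1) n = ?F \<tau> \<circ> transpose (n - 1) n" by simp
    then show "\<sigma> = \<tau>" by (simp only: comp_assoc transpose_comp_involutory comp_id)
  qed
  show ?thesis
    unfolding num_dipoles_def set_eq unfolding S_def[symmetric] using inj by (rule card_image)
qed

end

section \<open>Extracting the cycle count polynomial from Stanley's formula\<close>

text \<open>By Pascal's rule, multiplication by 1 - X lowers r by one. The induction starts at r = 1
  with \<open>count_series 1\<close>; at r = 0 the product would be 1 instead of X.\<close>

lemma rising_choose_series:
  assumes "0 < r"
  shows "(1 - fps_X) ^ Suc r * Abs_fps (\<lambda>t. of_nat ((t + r - 1) choose r) :: rat) = fps_X"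
  using assms
proof (induction r rule: nat_induct_non_zero)
  case 1
  have "Abs_fps (\<lambda>t. of_nat ((t + 1 - 1) choose 1) :: rat) = count_series 1"
    by (simp add: count_series_def)
  then show ?case using count_series_1 by (simp add: power2_eq_square mult.assoc)
next
  case (Suc r)
  let ?B = "\<lambda>r. Abs_fps (\<lambda>t. of_nat ((t + r - 1) choose r) :: rat)"
  have "(1 - fps_X) * ?B (Suc r) = ?B r"
  proof (rule fps_ext)
    fix t show "fps_nth ((1 - fps_X) * ?B (Suc r)) t = fps_nth (?B r) t"
      using Suc.hyps by (cases t) (simp_all add: algebra_simps binomial_eq_0)
  qed
  moreover have "(1 - fps_X) ^ Suc (Suc r) * ?B (Suc r) = (1 - fps_X) ^ Suc r * ((1 - fps_X) * ?B (Suc r))"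
    by (subst power_Suc2) (simp only: mult.assoc)
  ultimately show ?case using Suc.IH by (simp only:)
qed

text \<open>The common closed form of \<open>D_low\<close> and \<open>D_high\<close>: up to a
  factorial, the polynomial counting cycles for cycle type (p - 1, n - p).\<close>

definition dipole_poly :: "nat \<Rightarrow> nat \<Rightarrow> rat poly" where
  "dipole_poly n p = binom_poly (int n - 1) n + binom_poly 0 n
     - binom_poly (int n - int p) n - binom_poly (int p - 1) n"

lemma poly_dipole_poly:
  assumes "1 \<le> p" "p \<le> n"
  shows "poly (dipole_poly n p) (of_nat t) =
    of_nat ((t + (n - 1)) choose n) + of_nat (t choose n)
      - of_nat ((t + (n - p)) choose n) - of_nat ((t + (p - 1)) choose n)"
  using assms by (simp add: dipole_poly_def poly_binom_poly binomial_gbinomial of_nat_diff add_diff_eq)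

lemma poly_eq_if_eq_on_nats:
  fixes P Q :: "'a :: {idom, ring_char_0} poly"
  assumes "\<And>t::nat. poly P (of_nat t) = poly Q (of_nat t)"
  shows "P = Q"
proof (rule ccontr)
  assume "P \<noteq> Q"
  then have "finite {x. poly (P - Q) x = 0}" by (intro poly_roots_finite) simp
  moreover have "range of_nat \<subseteq> {x. poly (P - Q) x = 0}" using assms by auto
  ultimately have "finite (range (of_nat :: nat \<Rightarrow> 'a))" by (rule finite_subset[rotated])
  then show False using range_inj_infinite[OF inj_of_nat] by blast
qed

text \<open>The value of the left side at a natural number t is the coefficient of
  \<open>X ^ t\<close> in Stanley's series, and polynomials agreeing at all natural numbers are
  equal.\<close>

lemma sum_monom_cycle_count:
  assumes n: "4 \<le> n" and p: "2 \<le> p" "p \<le> n - 1"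
  shows "(\<Sum>\<sigma>\<in>cyclic_perms {1..n - 1}. monom 1 (cycle_count {1..n - 1} (\<sigma> \<circ> dipole_perm n p))) =
    smult (fact (n - 2)) (dipole_poly n p)" (is "?P = _")
proof (rule poly_eq_if_eq_on_nats)
  fix t :: nat
  let ?S = "{1..n - 1}" and ?B = "Abs_fps (\<lambda>t. of_nat ((t + n - 1) choose n) :: rat)"
  let ?T = "cycle_series ?S (dipole_perm n p)"
  have "(1 - fps_X) ^ Suc n * ?T =
      of_nat (fact (n - 2)) * fps_X * ((1 - fps_X ^ (p - 1)) * (1 - fps_X ^ (n - p)))"
    using cycle_series_eq[OF _ _ dipole_perm_permutes[OF n p]] cycle_weight_dipole_perm[OF n p] n
    by (simp add: numeral_2_eq_2)
  also have "\<dots> = of_nat (fact (n - 2)) * ((1 - fps_X) ^ Suc n * ?B) *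
      ((1 - fps_X ^ (p - 1)) * (1 - fps_X ^ (n - p)))"
    using n by (subst rising_choose_series) auto
  also have "\<dots> = (1 - fps_X) ^ Suc n *
      (of_nat (fact (n - 2)) * ((1 - fps_X ^ (p - 1)) * (1 - fps_X ^ (n - p)) * ?B))"
    by (simp only: mult_ac)
  also have "(1 - fps_X ^ (p - 1)) * (1 - fps_X ^ (n - p)) * ?B =
      ?B - fps_X ^ (p - 1) * ?B - fps_X ^ (n - p) * ?B + fps_X ^ (n - 1) * ?B"
  proof -
    have "fps_X ^ (n - 1) = fps_X ^ (p - 1) * (fps_X ^ (n - p) :: rat fps)"
      using n p by (simp flip: power_add)
    then show ?thesis by (simp add: algebra_simps)
  qed
  finally have T: "?T = of_nat (fact (n - 2)) *
      (?B - fps_X ^ (p - 1) * ?B - fps_X ^ (n - p) * ?B + fps_X ^ (n - 1) * ?B)"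
  proof -
    have "(1 - fps_X) ^ Suc n \<noteq> (0 :: rat fps)"
      using fps_X_neq_one by (metis power_not_zero right_minus_eq)
    then show "(1 - fps_X) ^ Suc n * ?T = (1 - fps_X) ^ Suc n * X \<Longrightarrow> ?T = X" for X
      by (simp only: mult_cancel_left) simp
  qed
  \<comment> \<open>For t < k the left side is 0, and so is the right side because the upper index
    is below n.\<close>
  have shift: "fps_nth (fps_X ^ k * ?B) t = of_nat ((t + (n - 1 - k)) choose n)" if "k \<le> n - 1" for k
    using that n by (auto simp: fps_X_power_mult_nth binomial_eq_0 intro!: arg_cong2[where f = binomial])
  have "poly ?P (of_nat t) = fps_nth ?T t"
    by (simp add: poly_sum poly_monom cycle_series_def fps_sum_nth count_series_def)
  also have "\<dots> = fact (n - 2) * poly (dipole_poly n p) (of_nat t)"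
  proof -
    have "fps_nth (of_nat (fact (n - 2)) * X) t = fact (n - 2) * fps_nth X t" for X :: "rat fps"
      by (metis fps_of_nat fps_mult_left_const_nth of_nat_fact)
    moreover have "fps_nth ?B t = of_nat ((t + (n - 1)) choose n)" using n by simp
    ultimately show ?thesis
      unfolding T using shift[of "p - 1"] shift[of "n - p"] shift[of "n - 1"] n p
      by (simp add: poly_dipole_poly)
  qed
  finally show "poly ?P (of_nat t) = poly (smult (fact (n - 2)) (dipole_poly n p)) (of_nat t)" by simp
qed

lemma num_dipoles_eq_coeff:
  assumes n: "4 \<le> n" and p: "2 \<le> p" "p \<le> n - 1"
  shows "rat_of_nat (num_dipoles n p g) = fact (n - 2) * coeff_int (dipole_poly n p) (int n - 2 * int g)"
proof (cases "int n - 2 * int g < 0")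
  case True
  \<comment> \<open>No permutation has a negative number of cycles, which matches the value 0 of
    \<open>coeff_int\<close> at negative indices.\<close>
  have "int a \<noteq> int n - 2 * int g" for a using True by linarith
  then show ?thesis using True by (simp add: num_dipoles_eq[OF n p] coeff_int_def)
next
  case False
  define k where "k = nat (int n - 2 * int g)"
  have k: "int n - 2 * int g = int k" using False by (simp add: k_def)
  let ?C = "cyclic_perms {1..n - 1}" and ?c = "\<lambda>\<sigma>. cycle_count {1..n - 1} (\<sigma> \<circ> dipole_perm n p)"
  have "fact (n - 2) * coeff (dipole_poly n p) k = coeff (\<Sum>\<sigma>\<in>?C. monom 1 (?c \<sigma>)) k"
    unfolding sum_monom_cycle_count[OF n p] by simp
  also have "\<dots> = (\<Sum>\<sigma>\<in>?C. if ?c \<sigma> = k then 1 else 0)" by (simp add: coeff_sum)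
  also have "\<dots> = of_nat (card {\<sigma> \<in> ?C. ?c \<sigma> = k})"
    using finite_cyclic_perms[of "{1..n - 1}"] by (simp add: sum.If_cases Int_def)
  finally show ?thesis by (simp add: num_dipoles_eq[OF n p] k coeff_int_def)
qed

section \<open>Telescoping the sums in \<open>D_low\<close> and \<open>D_high\<close>\<close>

text \<open>With y = t + n - k - 2, absorption reduces both binomials on the right to the one on the
  left, and the claim becomes (k + 1)(y + 1) + (n - k - 1)(y - n + 1) = n t.\<close>

lemma tvar_times_binom_poly:
  assumes "0 < n"
  shows "tvar * binom_poly (int n - k - 2) (n - 1) =
    smult (of_int (k + 1)) (binom_poly (int n - k - 1) n) +
    smult (of_int (int n - k - 1)) (binom_poly (int n - (k + 1) - 1) n)"
proof (rule poly_eq_if_eq_on_nats)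
  fix t :: nat
  obtain m where m: "n = Suc m" using assms gr0_implies_Suc by blast
  define y where "y = (of_nat t + of_int (int n - k - 2) :: rat)"
  have 1: "of_nat n * ((y + 1) gchoose n) = (y + 1) * (y gchoose m)"
    using gbinomial_absorption[of m "y + 1"] by (simp add: m)
  have 2: "of_nat n * (y gchoose n) = (y - of_nat m) * (y gchoose m)"
    using gbinomial_mult_1[of y m] by (simp add: m algebra_simps)
  have "of_nat n * (of_int (k + 1) * ((y + 1) gchoose n) + of_int (int n - k - 1) * (y gchoose n)) =
      of_int (k + 1) * (of_nat n * ((y + 1) gchoose n)) + of_int (int n - k - 1) * (of_nat n * (y gchoose n))"
    by (simp add: algebra_simps)
  also have "\<dots> = of_nat n * (of_nat t * (y gchoose m))"
    unfolding 1 2 by (simp add: y_def m algebra_simps)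
  finally have "of_nat t * (y gchoose m) =
      of_int (k + 1) * ((y + 1) gchoose n) + of_int (int n - k - 1) * (y gchoose n)"
    using assms by simp
  then show "poly (tvar * binom_poly (int n - k - 2) (n - 1)) (of_nat t) =
      poly (smult (of_int (k + 1)) (binom_poly (int n - k - 1) n) +
        smult (of_int (int n - k - 1)) (binom_poly (int n - (k + 1) - 1) n)) (of_nat t)"
    by (simp add: poly_binom_poly tvar_def y_def m algebra_simps)
qed

context
  fixes n p :: nat
  assumes n: "0 < n"
begin

text \<open>U and V are the two parts of the first summand under the partial fraction decomposition
  (n - 1)/(k (n - k - 1)) = 1/k + 1/(n - k - 1).\<close>

private definition U :: "int \<Rightarrow> rat poly" where
  "U k = smult (of_int (int n - int p) / of_int k) (binom_poly (int n - k - 1) n)"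

private definition V :: "int \<Rightarrow> rat poly" where
  "V k = smult (of_int (int n - int p) / of_int (int n - k - 1)) (binom_poly (int n - k - 1) n)"

private lemma first_summand:
  assumes "k \<noteq> 0" "k \<noteq> int n - 1"
  shows "smult (of_int ((int n - 1) * (int n - int p)) / of_int (k * (int n - k - 1)))
      (binom_poly (int n - k - 1) n) = U k + V k"
proof -
  have "k \<noteq> 0" "int n - k - 1 \<noteq> 0" using assms by auto
  then have nz: "(of_int k :: rat) \<noteq> 0" "(of_int (int n - k - 1) :: rat) \<noteq> 0"
    unfolding of_int_eq_0_iff by auto
  have "(of_int ((int n - 1) * (int n - int p)) / of_int (k * (int n - k - 1)) :: rat) =
      of_int (int n - int p) / of_int k + of_int (int n - int p) / of_int (int n - k - 1)"
    unfolding add_frac_eq[OF nz] of_int_mult[symmetric] of_int_add[symmetric] by (simp add: algebra_simps)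
  then show ?thesis by (simp only: U_def V_def smult_add_left)
qed

text \<open>Each term of \<open>tvar_times_binom_poly\<close> cancels one factor of the
  denominator.\<close>

private lemma second_summand:
  assumes "k \<noteq> - 1" "k \<noteq> int n - 1"
  shows "smult (of_int (int n - int p) / of_int ((int n - k - 1) * (k + 1)))
      (tvar * binom_poly (int n - k - 2) (n - 1)) = V k + U (k + 1)"
proof -
  have "k + 1 \<noteq> 0" "int n - k - 1 \<noteq> 0" using assms by auto
  then have nz: "(of_int (k + 1) :: rat) \<noteq> 0" "(of_int (int n - k - 1) :: rat) \<noteq> 0"
    unfolding of_int_eq_0_iff by auto
  show ?thesis
    unfolding tvar_times_binom_poly[OF n] U_def V_def smult_add_right smult_smult of_int_mult
    using nz by simp
qed

text \<open>The shift in \<open>U (k + 1)\<close> makes the second sum cover the U of the first and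
  one more at the top; its V reach one further at the bottom.\<close>

private lemma telescope_up:
  assumes "a \<le> b"
  shows "(\<Sum>k = a..b - 1. U k + V k) - (\<Sum>k = a - 1..b - 1. V k + U (k + 1)) = - V (a - 1) - U b"
  using assms
proof (induction b rule: int_ge_induct)
  case (step b)
  have "{a..b} = insert b {a..b - 1}" "{a - 1..b} = insert b {a - 1..b - 1}" using step by auto
  then show ?case using step by (simp add: algebra_simps)
qed simp

text \<open>Now the first kind of summand has the longer range, so the unmatched V sits at the upper
  end.\<close>

private lemma telescope_down:
  assumes "b \<le> a"
  shows "(\<Sum>k = b..a - 1. V k + U (k + 1)) - (\<Sum>k = b..a. U k + V k) = - V a - U b"
  using assms
proof (induction a rule: int_ge_induct)
  case (step a)
  have "{b..a} = insert a {b..a - 1}" "{b..a + 1} = insert (a + 1) {b..a}" using step by auto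
  then show ?case using step by (simp add: algebra_simps)
qed simp

text \<open>At these boundary indices the denominator is n - p and cancels the numerator.\<close>

private lemma U_V_ends:
  assumes "p < n"
  shows "U (int n - int p) = binom_poly (int p - 1) n" "V (int p - 1) = binom_poly (int n - int p) n"
proof -
  have "(of_int (int n - int p) :: rat) \<noteq> 0" using assms unfolding of_int_eq_0_iff by auto
  then show "U (int n - int p) = binom_poly (int p - 1) n" "V (int p - 1) = binom_poly (int n - int p) n"
    by (simp_all add: U_def V_def)
qed

lemma D_low_eq:
  assumes "2 \<le> p" "2 * p \<le> n"
  shows "D_low n p = dipole_poly n p"
proof -
  let ?a = "int p" and ?b = "int n - int p"
  have "range_sum ?a (int n - int p - 1)
      (\<lambda>k. smult (of_int ((int n - 1) * (int n - int p)) / of_int (k * (int n - k - 1)))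
               (binom_poly (int n - k - 1) n)) = (\<Sum>k = ?a..?b - 1. U k + V k)"
    using assms by (intro trans[OF range_sum_ordinary] sum.cong refl first_summand) auto
  moreover have "range_sum (?a - 1) (int n - int p - 1)
      (\<lambda>k. smult (of_int (int n - int p) / of_int ((int n - k - 1) * (k + 1)))
               (tvar * binom_poly (int n - k - 2) (n - 1))) = (\<Sum>k = ?a - 1..?b - 1. V k + U (k + 1))"
    using assms by (intro trans[OF range_sum_ordinary] sum.cong refl second_summand) auto
  moreover note telescope_up[of ?a ?b]
  ultimately show ?thesis
    unfolding D_low_def dipole_poly_def using assms U_V_ends by (simp add: algebra_simps)
qed

lemma D_high_eq:
  assumes "n < 2 * p" "p < n"
  shows "D_high n p = dipole_poly n p"
proof -
  let ?a = "int p - 1" and ?b = "int n - int p"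
  have "range_sum ?b ?a
      (\<lambda>k. smult (of_int ((int n - 1) * (int n - int p)) / of_int (k * (int n - k - 1)))
               (binom_poly (int n - k - 1) n)) = (\<Sum>k = ?b..?a. U k + V k)"
    using assms by (intro trans[OF range_sum_ordinary] sum.cong refl first_summand) auto
  moreover have "range_sum ?b (int p - 2)
      (\<lambda>k. smult (of_int (int n - int p) / of_int ((int n - k - 1) * (k + 1)))
               (tvar * binom_poly (int n - k - 2) (n - 1))) = (\<Sum>k = ?b..?a - 1. V k + U (k + 1))"
    using assms by (intro trans[OF range_sum_ordinary] sum.cong refl second_summand) auto
  moreover note telescope_down[of ?b ?a]
  ultimately show ?thesis
    unfolding D_high_def dipole_poly_def using assms U_V_ends by (simp add: algebra_simps)
qed

end

theorem mainTheorem9: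
  fixes n p g :: nat
  assumes "n \<ge> 4"
  shows "(2 \<le> p \<and> real p \<le> real n / 2 \<longrightarrow>
            rat_of_nat (num_dipoles n p g) = fact (n - 2) * coeff_int (D_low n p) (int n - 2 * int g)) \<and>
         (real n / 2 \<le> real p \<and> p \<le> n - 1 \<longrightarrow>
            rat_of_nat (num_dipoles n p g) = fact (n - 2) * coeff_int (D_high n p) (int n - 2 * int g))"
proof (intro conjI impI)
  assume "2 \<le> p \<and> real p \<le> real n / 2"
  then have p: "2 \<le> p" "2 * p \<le> n" by linarith+
  then have "p \<le> n - 1" by linarith
  then show "rat_of_nat (num_dipoles n p g) = fact (n - 2) * coeff_int (D_low n p) (int n - 2 * int g)"
    using num_dipoles_eq_coeff[OF assms] D_low_eq p assms by simp
next
  assume "real n / 2 \<le> real p \<and> p \<le> n - 1"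
  then have p: "n \<le> 2 * p" "p \<le> n - 1" by linarith+
  then have "2 \<le> p" using assms by linarith
  moreover have "D_high n p = dipole_poly n p"
  \<comment> \<open>At n = 2 p the last sum of \<open>D_high\<close> has reversed bounds and
    \<open>telescope_down\<close> does not apply, so this case is taken over from
    \<open>D_low\<close>.\<close>
  proof (cases "n = 2 * p")
    case True
    then show ?thesis using D_low_eq_D_high D_low_eq[of n p] assms by simp
  next
    case False
    then show ?thesis using p assms by (intro D_high_eq) auto
  qed
  ultimately show "rat_of_nat (num_dipoles n p g) = fact (n - 2) * coeff_int (D_high n p) (int n - 2 * int g)"
    using num_dipoles_eq_coeff[OF assms] p by simp
qed

end
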